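(* Let $\mathcal M$ be a Hausdorff topological space, $X$ a Banach space, $P:\mathcal M\to L(X)$ a projection-valued mapping, and $\ell:[a,b]\to\mathcal M$ a continuous path in $\mathcal M$. Assume that there are a well-ordered set $\Lambda\subset[a,b]$ (in the order of $\mathbb R$) with $\min\Lambda=a$, $\max\Lambda=b$ and a family $(z_\alpha)_{\alpha\in\Lambda}$ in $L(X)$ such that $A=P\circ\ell$ satisfies $A(t)=z_\alpha$ for $t\in[\alpha,S(\alpha))$, $\alpha\in\Lambda^{<b}$, and $A(b)=z_b$. Assume that $\lim_{\beta\to\gamma-}z_\beta=z_\gamma$ (over $\beta\in\Lambda$) for each limit element $\gamma\in\Lambda$, and that the family $(x_\alpha)_{\alpha\in\Lambda}$ given by $x_\alpha=I$ if $\alpha=a$ or $\alpha$ is a limit element, and $x_{S(\beta)}=I+z_{S(\beta)}-z_\beta$ for $\beta\in\Lambda^{<b}$, is multipliable, and its elements as well as its product are invertible. Then both the Kurzweil-Stieltjes product integral and the Kurzweil-Haahti product of $P\circ\ell$ exist, and $$\prod_a^bP(\ell(t))=\prod_a^b(I+\mathrm dP(\ell(t)))\cdot P(\ell(a))=\underset{\alpha\in\Lambda}{\Pi}z_\alpha.$$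
   Context: $L(X)$ is the Banach algebra of bounded linear operators on $X$, with identity $I$. $P$ is projection-valued if $P(x)P(x)=P(x)$ for all $x\in\mathcal M$. For a well-ordered $\Lambda$: $S(\beta)$ is the smallest element of $\Lambda$ greater than $\beta$; $\Lambda^{<\gamma}=\{\alpha\in\Lambda:\alpha<\gamma\}$; an element that is neither a successor $S(\beta)$ nor the minimum is a limit element. Multipliability: let $a=\min\Lambda$, $b=\sup\Lambda$. A family $(x_\alpha)_{\alpha\in\Lambda}$ in a unital normed algebra is multipliable if for every $\gamma\in\Lambda\cup\{b\}$ there is an element $\Pi_{\alpha\in\Lambda^{<\gamma}}x_\alpha$ such that: (i) $\Pi_{\alpha\in\Lambda^{<a}}x_\alpha=I$, and if $\gamma=S(\beta)$, $\beta\in\Lambda$, then $\Pi_{\alpha\in\Lambda^{<\gamma}}x_\alpha=x_\beta\cdot\Pi_{\alpha\in\Lambda^{<\beta}}x_\alpha$; (ii) if $\gamma$ is a limit element, then for each $\varepsilon>0$ there is $\beta_\varepsilon\in\Lambda^{<\gamma}$ with $\|\Pi_{\alpha\in\Lambda^{<\beta}}x_\alpha-\Pi_{\alpha\in\Lambda^{<\gamma}}x_\alpha\|<\varepsilon$ for all $\beta\in\Lambda\cap[\beta_\varepsilon,\gamma)$. If $b\in\Lambda$ (as here), the product is $\Pi_{\alpha\in\Lambda}x_\alpha=x_b\cdot\Pi_{\alpha\in\Lambda^{<b}}x_\alpha$. The final equality includes the assertion that $(z_\alpha)_{\alpha\in\Lambda}$ is multipliable. A tagged partition $(\xi_i,[t_{i-1},t_i])_{i=1}^m$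 of $[a,b]$ has $a=t_0<\dots<t_m=b$, $\xi_i\in[t_{i-1},t_i]$; for a gauge $\delta:[a,b]\to\mathbb R^+$ it is $\delta$-fine if $[t_{i-1},t_i]\subset(\xi_i-\delta(\xi_i),\xi_i+\delta(\xi_i))$ for all $i$. Kurzweil-Stieltjes product integral: $\prod_a^b(I+\mathrm dA(t))=Q$ if $Q$ is invertible and for every $\varepsilon>0$ there is a gauge $\delta$ with $\|(I+A(t_m)-A(t_{m-1}))\cdots(I+A(t_1)-A(t_0))-Q\|<\varepsilon$ for every $\delta$-fine tagged partition. Kurzweil-Haahti product: $\prod_a^bA(t)=P_A$ if $P_A\in L(X)$ (not necessarily invertible) and for every $\varepsilon>0$ there is a gauge $\delta$ with $\|P_A-A(t_m)A(t_{m-1})\cdots A(t_0)\|<\varepsilon$ for every $\delta$-fine tagged partition.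
   Formalization: The formal statement assumes in addition that the intervals [α,S(α)), α∈Λ^{<b}, cover [a,b) (i.e. Λ is closed); otherwise A is unconstrained on gaps and the claim fails, e.g. Λ={1−2^{-n}}∪{2}, all z_α=I, A=0 on [1,2). *)

theory Defs
  imports "HOL-Analysis.Analysis"
begin

section \<open>Operators\<close>

text \<open>
  \<open>L(X)\<close> is the type \<^typ>\<open>'x \<Rightarrow>\<^sub>L 'x\<close> with product \<open>o\<^sub>L\<close> and identity \<open>id_blinfun\<close>.
\<close>

definition invertible_op :: "('x::real_normed_vector \<Rightarrow>\<^sub>L 'x) \<Rightarrow> bool" where
  "invertible_op T \<longleftrightarrow> (\<exists>R. T o\<^sub>L R = id_blinfun \<and> R o\<^sub>L T = id_blinfun)"

definition projection_valued :: "('m \<Rightarrow> ('x::real_normed_vector \<Rightarrow>\<^sub>L 'x)) \<Rightarrow> bool" where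
  "projection_valued P \<longleftrightarrow> (\<forall>p. P p o\<^sub>L P p = P p)"

text \<open>\<open>lprod f n\<close> is \<open>f (n - 1) \<cdots> f 1 f 0\<close>: later factors stand on the left.\<close>

primrec lprod :: "(nat \<Rightarrow> ('x::real_normed_vector \<Rightarrow>\<^sub>L 'x)) \<Rightarrow> nat \<Rightarrow> ('x \<Rightarrow>\<^sub>L 'x)" where
  "lprod f 0 = id_blinfun"
| "lprod f (Suc n) = f n o\<^sub>L lprod f n"


section \<open>Well-ordered sets of reals\<close>

definition well_ordered :: "real set \<Rightarrow> bool" where
  "well_ordered \<Lambda> \<longleftrightarrow> well_order_on \<Lambda> {(s, t). s \<in> \<Lambda> \<and> t \<in> \<Lambda> \<and> s \<le> t}"

text \<open>Meaningful only if some element of \<open>\<Lambda>\<close> is greater than \<open>\<beta>\<close>.\<close>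

definition succ_in :: "real set \<Rightarrow> real \<Rightarrow> real" where
  "succ_in \<Lambda> \<beta> = (LEAST \<alpha>. \<alpha> \<in> \<Lambda> \<and> \<beta> < \<alpha>)"

definition min_of :: "real set \<Rightarrow> real" where
  "min_of \<Lambda> = (LEAST \<alpha>. \<alpha> \<in> \<Lambda>)"

text \<open>
  The guard \<open>\<beta> < \<gamma>\<close> excludes the junk value of \<^const>\<open>succ_in\<close> at a maximum of \<open>\<Lambda>\<close>.
\<close>

definition is_succ_of :: "real set \<Rightarrow> real \<Rightarrow> real \<Rightarrow> bool" where
  "is_succ_of \<Lambda> \<beta> \<gamma> \<longleftrightarrow> \<beta> \<in> \<Lambda> \<and> \<beta> < \<gamma> \<and> \<gamma> = succ_in \<Lambda> \<beta>"

text \<open>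
  Applied to the points \<open>\<gamma>\<close> of \<open>\<Lambda> \<union> {Sup \<Lambda>}\<close>; a supremum outside \<open>\<Lambda>\<close> counts as a limit element.
\<close>

definition limit_elem :: "real set \<Rightarrow> real \<Rightarrow> bool" where
  "limit_elem \<Lambda> \<gamma> \<longleftrightarrow>
     \<gamma> \<in> insert (Sup \<Lambda>) \<Lambda> \<and> \<gamma> \<noteq> min_of \<Lambda> \<and> \<not> (\<exists>\<beta>. is_succ_of \<Lambda> \<beta> \<gamma>)"


section \<open>Multipliable families\<close>

text \<open>\<open>p \<gamma>\<close> is the product of the \<open>x \<alpha>\<close> over \<open>\<alpha> \<in> \<Lambda>\<close>, \<open>\<alpha> < \<gamma>\<close>.\<close>

definition partial_products ::
  "real set \<Rightarrow> (real \<Rightarrow> ('x::real_normed_vector \<Rightarrow>\<^sub>L 'x)) \<Rightarrow> (real \<Rightarrow> ('x \<Rightarrow>\<^sub>L 'x)) \<Rightarrow> bool" where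
  "partial_products \<Lambda> x p \<longleftrightarrow>
     p (min_of \<Lambda>) = id_blinfun \<and>
     (\<forall>\<gamma>\<in>insert (Sup \<Lambda>) \<Lambda>. \<forall>\<beta>. is_succ_of \<Lambda> \<beta> \<gamma> \<longrightarrow> p \<gamma> = x \<beta> o\<^sub>L p \<beta>) \<and>
     (\<forall>\<gamma>. limit_elem \<Lambda> \<gamma> \<longrightarrow>
        (\<forall>\<epsilon>>0. \<exists>\<beta>\<^sub>0\<in>\<Lambda>. \<beta>\<^sub>0 < \<gamma> \<and> (\<forall>\<beta>\<in>\<Lambda> \<inter> {\<beta>\<^sub>0..<\<gamma>}. norm (p \<beta> - p \<gamma>) < \<epsilon>)))"

definition multipliable :: "real set \<Rightarrow> (real \<Rightarrow> ('x::real_normed_vector \<Rightarrow>\<^sub>L 'x)) \<Rightarrow> bool" where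
  "multipliable \<Lambda> x \<longleftrightarrow> (\<exists>p. partial_products \<Lambda> x p)"

definition has_family_product ::
  "real set \<Rightarrow> (real \<Rightarrow> ('x::real_normed_vector \<Rightarrow>\<^sub>L 'x)) \<Rightarrow> ('x \<Rightarrow>\<^sub>L 'x) \<Rightarrow> bool" where
  "has_family_product \<Lambda> x Q \<longleftrightarrow>
     (\<exists>p. partial_products \<Lambda> x p \<and>
          Q = (if Sup \<Lambda> \<in> \<Lambda> then x (Sup \<Lambda>) o\<^sub>L p (Sup \<Lambda>) else p (Sup \<Lambda>)))"

definition family_product ::
  "real set \<Rightarrow> (real \<Rightarrow> ('x::real_normed_vector \<Rightarrow>\<^sub>L 'x)) \<Rightarrow> ('x \<Rightarrow>\<^sub>L 'x)" where
  "family_product \<Lambda> x = (THE Q. has_family_product \<Lambda> x Q)"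


section \<open>Kurzweil product integrals\<close>

text \<open>
  The tag of the interval \<open>[t i, t (i + 1)]\<close> is \<open>\<xi> i\<close>, for \<open>i < m\<close>.  If \<open>a < b\<close>, then \<open>m \<ge> 1\<close>
  is forced; the empty partition \<open>m = 0\<close> occurs exactly for the degenerate interval \<open>a = b\<close>.
\<close>

definition tagged_partition ::
  "real \<Rightarrow> real \<Rightarrow> nat \<Rightarrow> (nat \<Rightarrow> real) \<Rightarrow> (nat \<Rightarrow> real) \<Rightarrow> bool" where
  "tagged_partition a b m \<xi> t \<longleftrightarrow>
     t 0 = a \<and> t m = b \<and> (\<forall>i<m. t i < t (Suc i) \<and> \<xi> i \<in> {t i..t (Suc i)})"

definition delta_fine ::
  "(real \<Rightarrow> real) \<Rightarrow> nat \<Rightarrow> (nat \<Rightarrow> real) \<Rightarrow> (nat \<Rightarrow> real) \<Rightarrow> bool" where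
  "delta_fine \<delta> m \<xi> t \<longleftrightarrow>
     (\<forall>i<m. {t i..t (Suc i)} \<subseteq> {\<xi> i - \<delta> (\<xi> i)<..<\<xi> i + \<delta> (\<xi> i)})"

definition has_KS_product ::
  "real \<Rightarrow> real \<Rightarrow> (real \<Rightarrow> ('x::real_normed_vector \<Rightarrow>\<^sub>L 'x)) \<Rightarrow> ('x \<Rightarrow>\<^sub>L 'x) \<Rightarrow> bool" where
  "has_KS_product a b A Q \<longleftrightarrow>
     invertible_op Q \<and>
     (\<forall>\<epsilon>>0. \<exists>\<delta>. (\<forall>s\<in>{a..b}. 0 < \<delta> s) \<and>
        (\<forall>m \<xi> t. tagged_partition a b m \<xi> t \<and> delta_fine \<delta> m \<xi> t \<longrightarrow>
           norm (lprod (\<lambda>i. id_blinfun + A (t (Suc i)) - A (t i)) m - Q) < \<epsilon>))"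

definition KS_product_exists ::
  "real \<Rightarrow> real \<Rightarrow> (real \<Rightarrow> ('x::real_normed_vector \<Rightarrow>\<^sub>L 'x)) \<Rightarrow> bool" where
  "KS_product_exists a b A \<longleftrightarrow> (\<exists>Q. has_KS_product a b A Q)"

definition KS_product ::
  "real \<Rightarrow> real \<Rightarrow> (real \<Rightarrow> ('x::real_normed_vector \<Rightarrow>\<^sub>L 'x)) \<Rightarrow> ('x \<Rightarrow>\<^sub>L 'x)" where
  "KS_product a b A = (THE Q. has_KS_product a b A Q)"

text \<open>The Kurzweil-Haahti product has the \<open>m + 1\<close> factors \<open>A (t m) \<cdots> A (t 0)\<close>.\<close>

definition has_KH_product ::
  "real \<Rightarrow> real \<Rightarrow> (real \<Rightarrow> ('x::real_normed_vector \<Rightarrow>\<^sub>L 'x)) \<Rightarrow> ('x \<Rightarrow>\<^sub>L 'x) \<Rightarrow> bool" where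
  "has_KH_product a b A Q \<longleftrightarrow>
     (\<forall>\<epsilon>>0. \<exists>\<delta>. (\<forall>s\<in>{a..b}. 0 < \<delta> s) \<and>
        (\<forall>m \<xi> t. tagged_partition a b m \<xi> t \<and> delta_fine \<delta> m \<xi> t \<longrightarrow>
           norm (Q - lprod (\<lambda>i. A (t i)) (Suc m)) < \<epsilon>))"

definition KH_product_exists ::
  "real \<Rightarrow> real \<Rightarrow> (real \<Rightarrow> ('x::real_normed_vector \<Rightarrow>\<^sub>L 'x)) \<Rightarrow> bool" where
  "KH_product_exists a b A \<longleftrightarrow> (\<exists>Q. has_KH_product a b A Q)"

definition KH_product ::
  "real \<Rightarrow> real \<Rightarrow> (real \<Rightarrow> ('x::real_normed_vector \<Rightarrow>\<^sub>L 'x)) \<Rightarrow> ('x \<Rightarrow>\<^sub>L 'x)" where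
  "KH_product a b A = (THE Q. has_KH_product a b A Q)"

end

(*
  Let U(t) be the product of the x_alpha over alpha <= t.  All values of U are invertible.  At a
  successor, I + A(t) - A(s) is exactly the jump U(t) U(s)^-1.  At a limit element gamma,
  U(gamma)^-1 (I + A(gamma) - A(s)) U(s) tends to I as s increases to gamma.  With W_j the product
  of the first j Kurzweil-Stieltjes factors of a partition, U(t_j)^-1 W_j therefore stays close to I
  for a suitable gauge, and W_m tends to U(b).  Since the values of A are idempotent,
  (I + A(t) - A(s)) A(s) = A(t) A(s), so the Kurzweil-Haahti product over a partition equals
  W_m A(a).  For the same reason the partial products of the z_alpha are those of the x_alpha
  multiplied by z_a on the right, except that the empty product is I.
*)

theory Submission
  imports Defs
begin

section \<open>Invertible operators\<close>

text \<open>Conjugation by the values of U turns factors that do not commute into I plus an error.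
  The errors can then be added without a uniform bound on U(t)^-1; only the norm of U(b) enters the
  final estimate. It is not enough that each error is small, since a fine partition may meet
  arbitrarily many limit elements. The error allowed on a partition interval is therefore the
  increment of one monotone function, and the total is bounded independently of the partition. The
  definition of multipliability supplies products over \<alpha> < \<gamma>, while U(\<gamma>) must
  contain the factor at \<gamma>, because A(\<gamma>) already includes the jump there. Invertibility
  is given only for the factors and for the whole product, so that of the intermediate values of U
  has to be derived.\<close>

interpretation compose: bounded_bilinear "(o\<^sub>L) :: ('b::real_normed_vector \<Rightarrow>\<^sub>L 'c::real_normed_vector) \<Rightarrow>
    ('a::real_normed_vector \<Rightarrow>\<^sub>L 'b) \<Rightarrow> ('a \<Rightarrow>\<^sub>L 'c)"
  by (rule bounded_bilinear_blinfun_compose)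

lemma blinfun_compose_assoc: "(R o\<^sub>L S) o\<^sub>L T = R o\<^sub>L (S o\<^sub>L T)"
  by (rule blinfun_eqI) simp

lemma blinfun_compose_id [simp]: "id_blinfun o\<^sub>L T = T" "T o\<^sub>L id_blinfun = T"
  by (rule blinfun_eqI, simp)+

lemma blinfun_compose_cancel:
  assumes "R o\<^sub>L S = id_blinfun"
  shows "R o\<^sub>L (S o\<^sub>L T) = T"
  using assms by (metis blinfun_compose_assoc blinfun_compose_id(1))

lemma invertible_op_compose:
  assumes "invertible_op S" "invertible_op T"
  shows "invertible_op (S o\<^sub>L T)"
proof -
  obtain S' T' where "S o\<^sub>L S' = id_blinfun" "S' o\<^sub>L S = id_blinfun"
    "T o\<^sub>L T' = id_blinfun" "T' o\<^sub>L T = id_blinfun"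
    using assms unfolding invertible_op_def by blast
  then have "(S o\<^sub>L T) o\<^sub>L (T' o\<^sub>L S') = id_blinfun" "(T' o\<^sub>L S') o\<^sub>L (S o\<^sub>L T) = id_blinfun"
    by (simp_all add: blinfun_compose_assoc blinfun_compose_cancel)
  then show ?thesis
    unfolding invertible_op_def by blast
qed

lemma invertible_op_cancel_left:
  assumes "invertible_op S" "invertible_op (S o\<^sub>L T)"
  shows "invertible_op T"
proof -
  obtain R where R: "S o\<^sub>L R = id_blinfun" "R o\<^sub>L S = id_blinfun"
    using assms(1) unfolding invertible_op_def by blast
  then have "invertible_op R"
    unfolding invertible_op_def by blast
  with assms(2) have "invertible_op (R o\<^sub>L (S o\<^sub>L T))"
    by (intro invertible_op_compose[of R])
  then show ?thesis
    using R by (simp add: blinfun_compose_cancel)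
qed

text \<open>The inverse is the sum \<open>R\<close> of the Neumann series. Its terms are built by
  multiplication on the left; \<open>comm\<close> yields the identity for the other order, so that
  \<open>R\<close> is a two-sided inverse.\<close>

lemma invertible_op_Neumann:
  fixes C :: "'x::banach \<Rightarrow>\<^sub>L 'x"
  assumes "norm C < 1"
  shows "invertible_op (id_blinfun - C)"
proof -
  define pw where "pw n = lprod (\<lambda>_. C) n" for n
  have comm: "pw n o\<^sub>L C = C o\<^sub>L pw n" for n
    by (induction n) (auto simp: pw_def blinfun_compose_assoc)
  have "norm (pw n) \<le> norm C ^ n" for n
  proof (induction n)
    case (Suc n)
    have "norm (pw (Suc n)) \<le> norm C * norm (pw n)"
      by (simp add: pw_def norm_blinfun_compose)
    with Suc show ?case
      by (smt (verit) mult_left_mono norm_ge_zero power_Suc)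
  qed (simp add: pw_def norm_blinfun_id_le)
  then have summ: "summable pw"
    using assms by (intro summable_comparison_test[OF _ summable_geometric[of "norm C"]]) auto
  define R where "R = suminf pw"
  have step: "(\<Sum>n. C o\<^sub>L pw n) = R - id_blinfun"
    using suminf_split_head[OF summ] by (simp add: R_def pw_def)
  have "C o\<^sub>L R = R - id_blinfun"
    using bounded_linear.suminf[OF compose.bounded_linear_right summ, of C] step
    by (simp add: R_def)
  moreover have "R o\<^sub>L C = R - id_blinfun"
    using bounded_linear.suminf[OF compose.bounded_linear_left summ, of C] step comm
    by (simp add: R_def)
  ultimately show ?thesis
    unfolding invertible_op_def
    by (intro exI[of _ R]) (simp add: compose.diff_left compose.diff_right)
qed

text \<open>If \<open>R\<close> inverts \<open>T\<close>, then \<open>R o\<^sub>L f s\<close> is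
  \<open>id_blinfun\<close> minus a term that tends to 0; the Neumann series inverts it, and
  \<open>R\<close> can be cancelled.\<close>

lemma invertible_op_eventually:
  fixes T :: "'x::banach \<Rightarrow>\<^sub>L 'x"
  assumes "invertible_op T" "(f \<longlongrightarrow> T) F"
  shows "\<forall>\<^sub>F s in F. invertible_op (f s)"
proof -
  obtain R where R: "T o\<^sub>L R = id_blinfun" "R o\<^sub>L T = id_blinfun"
    using assms(1) unfolding invertible_op_def by blast
  have invR: "invertible_op R"
    using R unfolding invertible_op_def by blast
  have "((\<lambda>s. R o\<^sub>L (T - f s)) \<longlongrightarrow> R o\<^sub>L (T - T)) F"
    by (intro tendsto_intros assms compose.tendsto)
  then have "\<forall>\<^sub>F s in F. norm (R o\<^sub>L (T - f s)) < 1"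
    using order_tendstoD(2)[OF tendsto_norm_zero zero_less_one] by simp
  then show ?thesis
  proof eventually_elim
    case (elim s)
    have "id_blinfun - (R o\<^sub>L (T - f s)) = R o\<^sub>L f s"
      using R by (simp add: compose.diff_right)
    then show ?case
      using invertible_op_Neumann[OF elim] invertible_op_cancel_left[OF invR] by simp
  qed
qed

section \<open>Fine tagged partitions\<close>

lemma tagged_partition_range:
  assumes "tagged_partition a b m \<xi> t" "i \<le> m"
  shows "a \<le> t i" "t i \<le> b"
proof -
  have mono: "t i \<le> t (Suc i)" if "i \<in> {..<m}" for i
    using assms(1) that by (auto simp: tagged_partition_def less_imp_le)
  have "t 0 \<le> t i" "t i \<le> t m"
    using assms(2) by (auto intro!: lift_Suc_mono_le_ivl[of "{..<m}" t, OF mono])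
  then show "a \<le> t i" "t i \<le> b"
    using assms by (auto simp: tagged_partition_def)
qed

lemma tagged_partition_append:
  assumes "tagged_partition u v m \<xi> t" "delta_fine \<delta> m \<xi> t"
    and "tagged_partition v w n \<eta> s" "delta_fine \<delta> n \<eta> s"
  shows "\<exists>k \<zeta> r. tagged_partition u w k \<zeta> r \<and> delta_fine \<delta> k \<zeta> r"
proof -
  define \<zeta> where "\<zeta> i = (if i < m then \<xi> i else \<eta> (i - m))" for i
  define r where "r i = (if i < m then t i else s (i - m))" for i
  \<comment> \<open>For \<open>Suc i = m\<close> the right endpoint is taken from the second
    partition: \<open>s 0 = v = t m\<close>.\<close>
  have *: "r i = t i \<and> r (Suc i) = t (Suc i) \<and> \<zeta> i = \<xi> i" if "i < m" for i
    using that assms(1,3)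
    by (cases "Suc i = m") (auto simp: r_def \<zeta>_def tagged_partition_def)
  have **: "r i = s (i - m) \<and> r (Suc i) = s (Suc (i - m)) \<and> \<zeta> i = \<eta> (i - m) \<and> i - m < n"
    if "\<not> i < m" "i < m + n" for i
    using that by (auto simp: r_def \<zeta>_def Suc_diff_le)
  have ends: "r 0 = u" "r (m + n) = w"
    using assms(1,3) by (auto simp: r_def tagged_partition_def)
  have "tagged_partition u w (m + n) \<zeta> r"
    unfolding tagged_partition_def
  proof (intro conjI ends allI impI)
    fix i assume i: "i < m + n"
    show "r i < r (Suc i)"
      using *[of i] **[of i] i assms(1,3) by (cases "i < m") (auto simp: tagged_partition_def)
    show "\<zeta> i \<in> {r i..r (Suc i)}"
      using *[of i] **[of i] i assms(1,3) by (cases "i < m") (auto simp: tagged_partition_def)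
  qed
  moreover have "delta_fine \<delta> (m + n) \<zeta> r"
    unfolding delta_fine_def
  proof (intro allI impI)
    fix i assume i: "i < m + n"
    show "{r i..r (Suc i)} \<subseteq> {\<zeta> i - \<delta> (\<zeta> i)<..<\<zeta> i + \<delta> (\<zeta> i)}"
      using *[of i] **[of i] i assms(2,4) by (cases "i < m") (simp_all add: delta_fine_def)
  qed
  ultimately show ?thesis by blast
qed

text \<open>Cousin's lemma, by bisection. It keeps the limits over fine partitions from being
  vacuous, on which the uniqueness behind the \<open>THE\<close> definitions rests.\<close>

lemma fine_tagged_partition_exists:
  assumes "a \<le> b" "\<forall>s\<in>{a..b}. 0 < \<delta> s"
  shows "\<exists>m \<xi> t. tagged_partition a b m \<xi> t \<and> delta_fine \<delta> m \<xi> t"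
  using assms(1)
proof (induction rule: Bolzano)
  case (trans u v w)
  then show ?case using tagged_partition_append by blast
next
  case (local s)
  show ?case
  proof (intro exI[of _ "\<delta> s"] conjI allI impI)
    show "0 < \<delta> s" using local assms by auto
    \<comment> \<open>An interval that contains \<open>s\<close> and is shorter than
      \<open>\<delta> s\<close> is fine by itself with tag \<open>s\<close>. For a single point the
      empty partition is taken, because partition points increase strictly.\<close>
    fix u v assume uv: "u \<le> s \<and> s \<le> v \<and> v - u < \<delta> s"
    show "\<exists>m \<xi> t. tagged_partition u v m \<xi> t \<and> delta_fine \<delta> m \<xi> t"
    proof (cases "u = v")
      case True
      then have "tagged_partition u v 0 (\<lambda>_. s) (\<lambda>_. u) \<and> delta_fine \<delta> 0 (\<lambda>_. s) (\<lambda>_. u)"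
        by (auto simp: tagged_partition_def delta_fine_def)
      then show ?thesis by blast
    next
      case False
      with uv have "tagged_partition u v 1 (\<lambda>_. s) (\<lambda>i. if i = 0 then u else v)
          \<and> delta_fine \<delta> 1 (\<lambda>_. s) (\<lambda>i. if i = 0 then u else v)"
        by (auto simp: tagged_partition_def delta_fine_def)
      then show ?thesis by blast
    qed
  qed
qed

section \<open>Limits along fine tagged partitions\<close>

text \<open>The common form of the two product integrals, so that uniqueness is proved once. The
  tags enter through fineness alone.\<close>

definition fine_limit ::
  "real \<Rightarrow> real \<Rightarrow> (nat \<Rightarrow> (nat \<Rightarrow> real) \<Rightarrow> 'y::real_normed_vector) \<Rightarrow> 'y \<Rightarrow> bool" where
  "fine_limit a b g Q \<longleftrightarrow>
     (\<forall>\<epsilon>>0. \<exists>\<delta>. (\<forall>s\<in>{a..b}. 0 < \<delta> s) \<and>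
        (\<forall>m \<xi> t. tagged_partition a b m \<xi> t \<and> delta_fine \<delta> m \<xi> t \<longrightarrow> norm (g m t - Q) < \<epsilon>))"

lemma fine_limitE:
  assumes "fine_limit a b g Q" "\<epsilon> > 0"
  obtains \<delta> where "\<forall>s\<in>{a..b}. 0 < \<delta> s"
    "\<And>m \<xi> t. tagged_partition a b m \<xi> t \<Longrightarrow> delta_fine \<delta> m \<xi> t \<Longrightarrow> norm (g m t - Q) < \<epsilon>"
  using assms(1)[unfolded fine_limit_def, rule_format, OF assms(2)] that by blast

lemma has_KS_product_iff:
  "has_KS_product a b A Q \<longleftrightarrow> invertible_op Q \<and>
     fine_limit a b (\<lambda>m t. lprod (\<lambda>i. id_blinfun + A (t (Suc i)) - A (t i)) m) Q"
  unfolding has_KS_product_def fine_limit_def by (rule refl)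

lemma has_KH_product_iff:
  "has_KH_product a b A Q \<longleftrightarrow> fine_limit a b (\<lambda>m t. lprod (\<lambda>i. A (t i)) (Suc m)) Q"
  unfolding has_KH_product_def fine_limit_def norm_minus_commute[of Q] by (rule refl)

text \<open>A partition that is fine for the pointwise minimum of two gauges would have a value
  closer to both limits than half their distance.\<close>

lemma fine_limit_unique:
  assumes "a \<le> b" and Q: "fine_limit a b g Q" and Q': "fine_limit a b g Q'"
  shows "Q = Q'"
proof (rule ccontr)
  assume "Q \<noteq> Q'"
  define \<epsilon> where "\<epsilon> = norm (Q - Q') / 2"
  have "\<epsilon> > 0" using \<open>Q \<noteq> Q'\<close> by (simp add: \<epsilon>_def)
  obtain \<delta>1 where pos1: "\<forall>s\<in>{a..b}. 0 < \<delta>1 s"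
    and 1: "\<And>m \<xi> t. tagged_partition a b m \<xi> t \<Longrightarrow> delta_fine \<delta>1 m \<xi> t \<Longrightarrow> norm (g m t - Q) < \<epsilon>"
    by (rule fine_limitE[OF Q \<open>\<epsilon> > 0\<close>]) blast
  obtain \<delta>2 where pos2: "\<forall>s\<in>{a..b}. 0 < \<delta>2 s"
    and 2: "\<And>m \<xi> t. tagged_partition a b m \<xi> t \<Longrightarrow> delta_fine \<delta>2 m \<xi> t \<Longrightarrow> norm (g m t - Q') < \<epsilon>"
    by (rule fine_limitE[OF Q' \<open>\<epsilon> > 0\<close>]) blast
  obtain m \<xi> t where part: "tagged_partition a b m \<xi> t"
    and fine: "delta_fine (\<lambda>s. min (\<delta>1 s) (\<delta>2 s)) m \<xi> t"
    using fine_tagged_partition_exists[OF \<open>a \<le> b\<close>, of "\<lambda>s. min (\<delta>1 s) (\<delta>2 s)"] pos1 pos2 by auto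
  have "delta_fine \<delta>1 m \<xi> t" "delta_fine \<delta>2 m \<xi> t"
    using fine unfolding delta_fine_def by fastforce+
  then have "norm (g m t - Q) < \<epsilon>" "norm (g m t - Q') < \<epsilon>"
    using 1 2 part by blast+
  then have "norm (Q - Q') < \<epsilon> + \<epsilon>"
    by (metis norm_diff_triangle_less norm_minus_commute)
  then show False by (simp add: \<epsilon>_def)
qed

lemma KS_product_eqI:
  assumes "a \<le> b" "has_KS_product a b A Q"
  shows "KS_product a b A = Q"
  using assms fine_limit_unique[OF assms(1)]
  unfolding KS_product_def has_KS_product_iff by (intro the_equality) auto

lemma KH_product_eqI:
  assumes "a \<le> b" "has_KH_product a b A Q"
  shows "KH_product a b A = Q"
  using assms fine_limit_unique[OF assms(1)]
  unfolding KH_product_def has_KH_product_iff by (intro the_equality) auto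

section \<open>Kurzweil-Haahti products of idempotents\<close>

lemma lprod_idempotents:
  assumes "\<And>i. A i o\<^sub>L A i = A i"
  shows "lprod A (Suc m) = lprod (\<lambda>i. id_blinfun + A (Suc i) - A i) m o\<^sub>L A 0"
proof (induction m)
  case (Suc m)
  \<comment> \<open>The leftmost factor of \<open>lprod A (Suc m)\<close> is \<open>A m\<close>, so
    idempotence makes \<open>id_blinfun - A m\<close> annihilate the product.\<close>
  have abs: "A m o\<^sub>L lprod A (Suc m) = lprod A (Suc m)"
    by (simp add: assms blinfun_compose_assoc[symmetric])
  have "lprod (\<lambda>i. id_blinfun + A (Suc i) - A i) (Suc m) o\<^sub>L A 0
      = (id_blinfun + A (Suc m) - A m) o\<^sub>L lprod A (Suc m)"
    unfolding Suc lprod.simps(2)[of "\<lambda>i. id_blinfun + A (Suc i) - A i"] by (rule blinfun_compose_assoc)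
  also have "\<dots> = A (Suc m) o\<^sub>L lprod A (Suc m)"
    using abs by (simp add: compose.add_left compose.diff_left del: lprod.simps)
  finally show ?case by simp
qed simp

text \<open>On every partition the two products differ exactly by the right factor
  \<open>A a\<close>, so a gauge for the first limit also serves for the second, up to a factor
  \<open>norm (A a)\<close> in the error.\<close>

lemma has_KH_product_idempotent:
  fixes A :: "real \<Rightarrow> ('x::real_normed_vector \<Rightarrow>\<^sub>L 'x)"
  assumes idem: "\<And>t. A t o\<^sub>L A t = A t" and KS: "has_KS_product a b A Q"
  shows "has_KH_product a b A (Q o\<^sub>L A a)"
  unfolding has_KH_product_iff fine_limit_def
proof (intro allI impI)
  fix \<epsilon> :: real assume "\<epsilon> > 0"
  define W :: "nat \<Rightarrow> (nat \<Rightarrow> real) \<Rightarrow> ('x \<Rightarrow>\<^sub>L 'x)"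
    where "W m t = lprod (\<lambda>i. id_blinfun + A (t (Suc i)) - A (t i)) m" for m t
  \<comment> \<open>The added 1 keeps the denominator positive when \<open>A a = 0\<close>.\<close>
  define e where "e = \<epsilon> / (norm (A a) + 1)"
  have pos: "norm (A a) + 1 > 0" using norm_ge_zero[of "A a"] by linarith
  with \<open>\<epsilon> > 0\<close> have "e > 0" by (simp add: e_def)
  have "fine_limit a b W Q"
    using KS unfolding has_KS_product_iff W_def by simp
  from this \<open>e > 0\<close> obtain \<delta> where \<delta>: "\<forall>s\<in>{a..b}. 0 < \<delta> s"
    and fine: "\<And>m \<xi> t. tagged_partition a b m \<xi> t \<Longrightarrow> delta_fine \<delta> m \<xi> t \<Longrightarrow> norm (W m t - Q) < e"
    by (rule fine_limitE) blast
  have "norm (lprod (\<lambda>i. A (t i)) (Suc m) - (Q o\<^sub>L A a)) < \<epsilon>"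
    if "tagged_partition a b m \<xi> t" "delta_fine \<delta> m \<xi> t" for m \<xi> t
  proof -
    have "t 0 = a" using that by (simp add: tagged_partition_def)
    then have "lprod (\<lambda>i. A (t i)) (Suc m) = W m t o\<^sub>L A a"
      using lprod_idempotents[of "\<lambda>i. A (t i)" m] idem unfolding W_def by simp
    then have "norm (lprod (\<lambda>i. A (t i)) (Suc m) - (Q o\<^sub>L A a)) = norm ((W m t - Q) o\<^sub>L A a)"
      by (simp only: compose.diff_left)
    also have "\<dots> \<le> norm (W m t - Q) * norm (A a)"
      by (rule norm_blinfun_compose)
    also have "\<dots> \<le> e * norm (A a)"
      using fine[OF that] by (intro mult_right_mono) auto
    also have "\<dots> < e * (norm (A a) + 1)"
      using \<open>e > 0\<close> by simp
    also have "\<dots> = \<epsilon>"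
      using pos by (simp add: e_def)
    finally show ?thesis .
  qed
  with \<delta> show "\<exists>\<delta>. (\<forall>s\<in>{a..b}. 0 < \<delta> s) \<and>
    (\<forall>m \<xi> t. tagged_partition a b m \<xi> t \<and> delta_fine \<delta> m \<xi> t \<longrightarrow>
       norm (lprod (\<lambda>i. A (t i)) (Suc m) - (Q o\<^sub>L A a)) < \<epsilon>)"
    by blast
qed

section \<open>Perturbed telescoping products\<close>

text \<open>A discrete Gronwall estimate. If every \<open>F i\<close> were
  \<open>U (Suc i) o\<^sub>L V i\<close>, the product would telescope and the difference vanish. In
  general the conjugated product \<open>Y j\<close> is multiplied in each step by I plus an error of
  norm at most the increment of \<open>h\<close>, and a product of numbers 1 + d is at most the
  exponential of the sum of the d.\<close>

lemma lprod_conjugated_bound: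
  fixes F U V :: "nat \<Rightarrow> ('x::real_normed_vector \<Rightarrow>\<^sub>L 'x)" and h :: "nat \<Rightarrow> real"
  assumes inv: "\<And>i. i \<le> m \<Longrightarrow> U i o\<^sub>L V i = id_blinfun" "\<And>i. i \<le> m \<Longrightarrow> V i o\<^sub>L U i = id_blinfun"
    and step: "\<And>i. i < m \<Longrightarrow> norm ((V (Suc i) o\<^sub>L (F i o\<^sub>L U i)) - id_blinfun) \<le> h (Suc i) - h i"
  shows "norm ((lprod F m o\<^sub>L U 0) - U m) \<le> norm (U m) * (exp (h m - h 0) - 1)"
proof -
  define Y where "Y j = V j o\<^sub>L (lprod F j o\<^sub>L U 0)" for j
  have "norm (Y j - id_blinfun) \<le> exp (h j - h 0) - 1" if "j \<le> m" for j
    using that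
  proof (induction j)
    case 0
    then show ?case using inv(2)[of 0] by (simp add: Y_def)
  next
    case (Suc j)
    define E where "E = (V (Suc j) o\<^sub>L (F j o\<^sub>L U j)) - id_blinfun"
    have IH: "norm (Y j - id_blinfun) \<le> exp (h j - h 0) - 1"
      using Suc by simp
    have E: "norm E \<le> h (Suc j) - h j"
      using step Suc.prems unfolding E_def by simp
    have Yj: "norm (Y j) \<le> exp (h j - h 0)"
      using IH norm_triangle_sub[of "Y j" id_blinfun] norm_blinfun_id_le[where 'a='x] by linarith
    \<comment> \<open>The identity \<open>U j o\<^sub>L V j = id_blinfun\<close> is inserted between
      \<open>F j\<close> and \<open>lprod F j\<close>.\<close>
    have "Y (Suc j) = (V (Suc j) o\<^sub>L (F j o\<^sub>L U j)) o\<^sub>L Y j"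
      using Suc.prems by (simp add: Y_def blinfun_compose_assoc blinfun_compose_cancel[OF inv(1)])
    also have "\<dots> = Y j + (E o\<^sub>L Y j)"
      by (simp add: E_def compose.diff_left)
    finally have "norm (Y (Suc j) - id_blinfun) \<le> norm (Y j - id_blinfun) + norm (E o\<^sub>L Y j)"
      using norm_triangle_ineq[of "Y j - id_blinfun" "E o\<^sub>L Y j"] by (simp add: algebra_simps)
    also have "norm (E o\<^sub>L Y j) \<le> norm E * norm (Y j)"
      by (rule norm_blinfun_compose)
    also have "\<dots> \<le> (h (Suc j) - h j) * exp (h j - h 0)"
      by (intro mult_mono E Yj norm_ge_zero order_trans[OF norm_ge_zero E])
    finally have "norm (Y (Suc j) - id_blinfun)
        \<le> exp (h j - h 0) * (1 + (h (Suc j) - h j)) - 1"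
      using IH by (simp add: algebra_simps)
    also have "\<dots> \<le> exp (h j - h 0) * exp (h (Suc j) - h j) - 1"
      using exp_ge_add_one_self[of "h (Suc j) - h j"] by simp
    also have "\<dots> = exp (h (Suc j) - h 0) - 1"
      by (simp flip: exp_add)
    finally show ?case .
  qed
  then have "norm (Y m - id_blinfun) \<le> exp (h m - h 0) - 1" by simp
  \<comment> \<open>Undoing the conjugation costs only the norm of the last value
    \<open>U m\<close>.\<close>
  moreover have "(lprod F m o\<^sub>L U 0) - U m = U m o\<^sub>L (Y m - id_blinfun)"
    using inv(1) by (simp add: Y_def compose.diff_right blinfun_compose_cancel)
  ultimately show ?thesis
    using order_trans[OF norm_blinfun_compose mult_left_mono[OF _ norm_ge_zero]] by simp
qed

section \<open>Well-ordered step sets\<close>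

text \<open>The assumption \<open>cover\<close> keeps suprema of nonempty subsets of \<Lambda>
  inside \<Lambda>, since a missing one would lie in no step. Limit elements, which are defined by
  the order alone, thereby become limits from the left in the topology of the reals.\<close>

locale step_set =
  fixes \<Lambda> :: "real set" and a b :: real
  assumes well_ordered: "well_ordered \<Lambda>"
    and subset: "\<Lambda> \<subseteq> {a..b}"
    and a_in: "a \<in> \<Lambda>" and b_in: "b \<in> \<Lambda>"
    and cover: "{a..<b} \<subseteq> (\<Union>\<alpha>\<in>\<Lambda> \<inter> {..<b}. {\<alpha>..<succ_in \<Lambda> \<alpha>})"
begin

lemma le_b: "\<alpha> \<in> \<Lambda> \<Longrightarrow> \<alpha> \<le> b" and ge_a: "\<alpha> \<in> \<Lambda> \<Longrightarrow> a \<le> \<alpha>"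
  using subset by auto

lemma a_le_b: "a \<le> b"
  using le_b a_in by blast

lemma least_exists:
  assumes "B \<subseteq> \<Lambda>" "B \<noteq> {}"
  shows "\<exists>m\<in>B. \<forall>\<alpha>\<in>B. m \<le> \<alpha>"
proof -
  have "wf ({(s, t). s \<in> \<Lambda> \<and> t \<in> \<Lambda> \<and> s \<le> t} - Id)"
    using well_ordered unfolding well_ordered_def well_order_on_def by blast
  then obtain m where "m \<in> B" "\<And>y. (y, m) \<in> {(s, t). s \<in> \<Lambda> \<and> t \<in> \<Lambda> \<and> s \<le> t} - Id \<Longrightarrow> y \<notin> B"
    by (rule wfE_min'[OF _ assms(2)]) blast
  then have "\<forall>\<alpha>\<in>B. m \<le> \<alpha>"
    using assms(1) by force
  with \<open>m \<in> B\<close> show ?thesis by blast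
qed

lemma succ_in_props:
  assumes "\<beta> \<in> \<Lambda>" "\<beta> < b"
  shows succ_in_mem: "succ_in \<Lambda> \<beta> \<in> \<Lambda>" and succ_in_greater: "\<beta> < succ_in \<Lambda> \<beta>"
    and succ_in_le: "\<And>\<alpha>. \<alpha> \<in> \<Lambda> \<Longrightarrow> \<beta> < \<alpha> \<Longrightarrow> succ_in \<Lambda> \<beta> \<le> \<alpha>"
proof -
  obtain m where m: "m \<in> \<Lambda>" "\<beta> < m" "\<And>\<alpha>. \<alpha> \<in> \<Lambda> \<Longrightarrow> \<beta> < \<alpha> \<Longrightarrow> m \<le> \<alpha>"
    using least_exists[of "\<Lambda> \<inter> {\<beta><..}"] assms b_in by auto
  have "succ_in \<Lambda> \<beta> = m"
    unfolding succ_in_def using m by (intro Least_equality) auto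
  with m show "succ_in \<Lambda> \<beta> \<in> \<Lambda>" "\<beta> < succ_in \<Lambda> \<beta>"
    "\<And>\<alpha>. \<alpha> \<in> \<Lambda> \<Longrightarrow> \<beta> < \<alpha> \<Longrightarrow> succ_in \<Lambda> \<beta> \<le> \<alpha>"
    by auto
qed

lemma min_of_eq: "min_of \<Lambda> = a"
  unfolding min_of_def using a_in ge_a by (intro Least_equality) auto

lemma Sup_eq: "Sup \<Lambda> = b"
  using b_in le_b by (intro cSup_eq_maximum) auto

text \<open>The inequality \<open>succ_in \<Lambda> \<beta> \<le> \<gamma>\<close> holds whenever
  \<beta> < \<gamma> in \<Lambda>, so that \<gamma> fails to be a successor exactly if it is always
  strict. The supremum in the definition is \<open>b\<close>, an element of \<Lambda>.\<close>

lemma limit_elem_iff: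
  "limit_elem \<Lambda> \<gamma> \<longleftrightarrow> \<gamma> \<in> \<Lambda> \<and> a < \<gamma> \<and> (\<forall>\<beta>\<in>\<Lambda>. \<beta> < \<gamma> \<longrightarrow> succ_in \<Lambda> \<beta> < \<gamma>)"
proof (cases "\<gamma> \<in> \<Lambda>")
  case True
  then have "succ_in \<Lambda> \<beta> \<le> \<gamma>" if "\<beta> \<in> \<Lambda>" "\<beta> < \<gamma>" for \<beta>
    using succ_in_le that le_b by fastforce
  with True show ?thesis
    using ge_a[OF True] unfolding limit_elem_def min_of_eq Sup_eq is_succ_of_def
    by (auto simp: order_less_le)
qed (use b_in in \<open>auto simp: limit_elem_def Sup_eq\<close>)

lemma limit_elemD:
  assumes "limit_elem \<Lambda> \<gamma>"
  shows "\<gamma> \<in> \<Lambda>" "a < \<gamma>" "\<And>\<beta>. \<beta> \<in> \<Lambda> \<Longrightarrow> \<beta> < \<gamma> \<Longrightarrow> succ_in \<Lambda> \<beta> < \<gamma>"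
  using assms unfolding limit_elem_iff by auto

lemma less_limit_less_b:
  assumes "limit_elem \<Lambda> \<gamma>" "\<beta> < \<gamma>"
  shows "\<beta> < b"
  using le_b limit_elemD(1)[OF assms(1)] assms(2) by force

lemma elem_cases:
  assumes "\<gamma> \<in> \<Lambda>"
  obtains "\<gamma> = a" | \<beta> where "\<beta> \<in> \<Lambda>" "\<beta> < b" "\<gamma> = succ_in \<Lambda> \<beta>" | "limit_elem \<Lambda> \<gamma>"
proof (cases "\<gamma> = a \<or> limit_elem \<Lambda> \<gamma>")
  case False
  then obtain \<beta> where "is_succ_of \<Lambda> \<beta> \<gamma>"
    using assms unfolding limit_elem_def min_of_eq by auto
  then have "\<beta> \<in> \<Lambda>" "\<beta> < b" "\<gamma> = succ_in \<Lambda> \<beta>"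
    using le_b[OF assms] by (auto simp: is_succ_of_def)
  then show ?thesis using that by blast
qed (use that in blast)

text \<open>Transfinite induction: a least counterexample would fall under one of the three
  cases.\<close>

lemma elem_induct [consumes 1, case_names min succ limit]:
  assumes "\<gamma> \<in> \<Lambda>"
    and "Q a"
    and "\<And>\<beta>. \<beta> \<in> \<Lambda> \<Longrightarrow> \<beta> < b \<Longrightarrow> Q \<beta> \<Longrightarrow> Q (succ_in \<Lambda> \<beta>)"
    and "\<And>\<gamma>. limit_elem \<Lambda> \<gamma> \<Longrightarrow> (\<And>\<beta>. \<beta> \<in> \<Lambda> \<Longrightarrow> \<beta> < \<gamma> \<Longrightarrow> Q \<beta>) \<Longrightarrow> Q \<gamma>"
  shows "Q \<gamma>"
proof (rule ccontr)
  assume "\<not> Q \<gamma>"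
  then obtain m where m: "m \<in> \<Lambda>" "\<not> Q m" "\<And>\<alpha>. \<alpha> \<in> \<Lambda> \<Longrightarrow> \<alpha> < m \<Longrightarrow> Q \<alpha>"
    using least_exists[of "{\<alpha>\<in>\<Lambda>. \<not> Q \<alpha>}"] assms(1) by force
  from m(1) show False
  proof (cases rule: elem_cases)
    case (2 \<beta>)
    then have "Q \<beta>" using m(3) succ_in_greater by blast
    with 2 assms(3) m(2) show False by blast
  qed (use m assms(2,4) in blast)+
qed

section \<open>The step containing a point\<close>

text \<open>The index of the step that contains \<open>t\<close>, so that A(t) is
  \<open>z (last_elem t)\<close>. In a well-ordered set of reals a greatest element up to
  \<open>t\<close> may fail to exist; here \<open>cover\<close> provides it for \<open>t\<close> in
  \<open>{a..b}\<close>.\<close>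

definition last_elem :: "real \<Rightarrow> real" where
  "last_elem t = (GREATEST \<alpha>. \<alpha> \<in> \<Lambda> \<and> \<alpha> \<le> t)"

lemma last_elem_eqI:
  assumes "\<alpha> \<in> \<Lambda>" "\<alpha> \<le> t" "\<And>\<beta>. \<beta> \<in> \<Lambda> \<Longrightarrow> \<beta> \<le> t \<Longrightarrow> \<beta> \<le> \<alpha>"
  shows "last_elem t = \<alpha>"
  unfolding last_elem_def using assms by (intro Greatest_equality) auto

lemma last_elem_step:
  assumes "\<alpha> \<in> \<Lambda>" "\<alpha> < b" "t \<in> {\<alpha>..<succ_in \<Lambda> \<alpha>}"
  shows "last_elem t = \<alpha>"
  using assms succ_in_le[OF assms(1,2)] by (intro last_elem_eqI) force+

lemma last_elem_self: "\<alpha> \<in> \<Lambda> \<Longrightarrow> last_elem \<alpha> = \<alpha>"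
  by (intro last_elem_eqI) auto

lemma step_cases:
  assumes "t \<in> {a..b}"
  obtains "t = b" "last_elem t = b"
  | "last_elem t \<in> \<Lambda>" "last_elem t < b" "t \<in> {last_elem t..<succ_in \<Lambda> (last_elem t)}"
proof (cases "t = b")
  case False
  then obtain \<alpha> where "\<alpha> \<in> \<Lambda>" "\<alpha> < b" "t \<in> {\<alpha>..<succ_in \<Lambda> \<alpha>}"
    using cover assms by fastforce
  with last_elem_step show ?thesis using that(2) by metis
next
  case True
  with last_elem_self[OF b_in] show ?thesis by (intro that(1)) simp_all
qed

lemma last_elem_mem: "t \<in> {a..b} \<Longrightarrow> last_elem t \<in> \<Lambda>"
  by (erule step_cases) (use b_in in auto)

lemma last_elem_le: "t \<in> {a..b} \<Longrightarrow> last_elem t \<le> t"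
  by (erule step_cases) auto

lemma last_elem_ge:
  assumes "t \<in> {a..b}" "\<beta> \<in> \<Lambda>" "\<beta> \<le> t"
  shows "\<beta> \<le> last_elem t"
  using assms(1)
proof (cases rule: step_cases)
  case 2
  have "\<not> last_elem t < \<beta>"
    using succ_in_le[OF 2(1,2) assms(2)] 2(3) assms(3) by auto
  then show ?thesis by simp
qed (use assms in auto)

text \<open>The step containing \<open>max a s\<close> starts before \<gamma>; its successor is
  still below the limit element \<gamma> and already beyond \<open>s\<close>. The maximum keeps the
  point inside the covered interval.\<close>

lemma elem_below_limit:
  assumes "limit_elem \<Lambda> \<gamma>" "s < \<gamma>"
  shows "\<exists>\<beta>\<in>\<Lambda>. s < \<beta> \<and> \<beta> < \<gamma>"
proof -
  define t where "t = max a s"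
  have t: "t < \<gamma>" "t \<in> {a..b}"
    using limit_elemD(2)[OF assms(1)] le_b[OF limit_elemD(1)[OF assms(1)]] assms(2)
    by (auto simp: t_def)
  from t(2) show ?thesis
  proof (cases rule: step_cases)
    case 1
    then show ?thesis using t(1) le_b[OF limit_elemD(1)[OF assms(1)]] by simp
  next
    case 2
    then have "succ_in \<Lambda> (last_elem t) < \<gamma>"
      using limit_elemD(3)[OF assms(1) 2(1)] t(1) by simp
    with 2 show ?thesis
      by (intro bexI[of _ "succ_in \<Lambda> (last_elem t)"] succ_in_mem) (auto simp: t_def)
  qed
qed

section \<open>Left limits along \<Lambda>\<close>

abbreviation below :: "real \<Rightarrow> real filter" where
  "below \<gamma> \<equiv> at \<gamma> within \<Lambda> \<inter> {..<\<gamma>}"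

text \<open>Metric neighbourhoods of \<gamma> and tails of the order generate the same filter,
  because \<Lambda> accumulates at \<gamma> from the left. The \<epsilon>-conditions on partial
  products thus become ordinary limits.\<close>

lemma eventually_below:
  assumes "limit_elem \<Lambda> \<gamma>"
  shows "eventually Q (below \<gamma>) \<longleftrightarrow> (\<exists>\<beta>\<^sub>0\<in>\<Lambda>. \<beta>\<^sub>0 < \<gamma> \<and> (\<forall>\<beta>\<in>\<Lambda> \<inter> {\<beta>\<^sub>0..<\<gamma>}. Q \<beta>))"
proof
  assume "eventually Q (below \<gamma>)"
  then obtain d where d: "d > 0" "\<forall>\<beta>\<in>\<Lambda> \<inter> {..<\<gamma>}. \<beta> \<noteq> \<gamma> \<and> dist \<beta> \<gamma> < d \<longrightarrow> Q \<beta>"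
    unfolding eventually_at by blast
  obtain \<beta>\<^sub>0 where "\<beta>\<^sub>0 \<in> \<Lambda>" "\<gamma> - d < \<beta>\<^sub>0" "\<beta>\<^sub>0 < \<gamma>"
    using elem_below_limit[OF assms, of "\<gamma> - d"] d(1) by auto
  with d(2) show "\<exists>\<beta>\<^sub>0\<in>\<Lambda>. \<beta>\<^sub>0 < \<gamma> \<and> (\<forall>\<beta>\<in>\<Lambda> \<inter> {\<beta>\<^sub>0..<\<gamma>}. Q \<beta>)"
    by (intro bexI[of _ \<beta>\<^sub>0]) (auto simp: dist_real_def)
next
  assume "\<exists>\<beta>\<^sub>0\<in>\<Lambda>. \<beta>\<^sub>0 < \<gamma> \<and> (\<forall>\<beta>\<in>\<Lambda> \<inter> {\<beta>\<^sub>0..<\<gamma>}. Q \<beta>)"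
  then obtain \<beta>\<^sub>0 where "\<beta>\<^sub>0 < \<gamma>" "\<forall>\<beta>\<in>\<Lambda> \<inter> {\<beta>\<^sub>0..<\<gamma>}. Q \<beta>" by blast
  then show "eventually Q (below \<gamma>)"
    unfolding eventually_at by (intro exI[of _ "\<gamma> - \<beta>\<^sub>0"]) (auto simp: dist_real_def)
qed

lemma below_neq_bot:
  assumes "limit_elem \<Lambda> \<gamma>"
  shows "below \<gamma> \<noteq> bot"
  unfolding trivial_limit_def eventually_below[OF assms] by auto

lemma eventually_below_less:
  assumes "limit_elem \<Lambda> \<gamma>"
  shows "\<forall>\<^sub>F \<beta> in below \<gamma>. \<beta> \<in> \<Lambda> \<and> a < \<beta> \<and> \<beta> < \<gamma> \<and> \<beta> < b"
proof -
  obtain \<beta>\<^sub>0 where "\<beta>\<^sub>0 \<in> \<Lambda>" "a < \<beta>\<^sub>0" "\<beta>\<^sub>0 < \<gamma>"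
    using elem_below_limit[OF assms limit_elemD(2)[OF assms]] by blast
  then show ?thesis
    unfolding eventually_below[OF assms] using less_limit_less_b[OF assms]
    by (intro bexI[of _ \<beta>\<^sub>0]) auto
qed

text \<open>Successors of elements below a limit element stay below it, so tails are mapped into
  tails. This carries limits of the products over \<alpha> < \<gamma> to those over \<alpha> \<le>
  \<gamma>.\<close>

lemma filterlim_succ_below:
  assumes "limit_elem \<Lambda> \<gamma>"
  shows "filterlim (succ_in \<Lambda>) (below \<gamma>) (below \<gamma>)"
  unfolding filterlim_iff
proof (intro allI impI)
  fix Q assume "eventually Q (below \<gamma>)"
  then obtain \<beta>\<^sub>0 where \<beta>\<^sub>0: "\<beta>\<^sub>0 \<in> \<Lambda>" "\<beta>\<^sub>0 < \<gamma>" "\<And>\<beta>. \<beta> \<in> \<Lambda> \<Longrightarrow> \<beta>\<^sub>0 \<le> \<beta> \<Longrightarrow> \<beta> < \<gamma> \<Longrightarrow> Q \<beta>"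
    unfolding eventually_below[OF assms] by auto
  have "Q (succ_in \<Lambda> \<beta>)" if "\<beta> \<in> \<Lambda> \<inter> {\<beta>\<^sub>0..<\<gamma>}" for \<beta>
  proof (rule \<beta>\<^sub>0(3))
    have \<beta>: "\<beta> \<in> \<Lambda>" "\<beta> < b" using that less_limit_less_b[OF assms] by auto
    show "succ_in \<Lambda> \<beta> \<in> \<Lambda>" "\<beta>\<^sub>0 \<le> succ_in \<Lambda> \<beta>" "succ_in \<Lambda> \<beta> < \<gamma>"
      using succ_in_mem[OF \<beta>] succ_in_greater[OF \<beta>] limit_elemD(3)[OF assms \<beta>(1)] that by auto
  qed
  with \<beta>\<^sub>0(1,2) show "\<forall>\<^sub>F \<beta> in below \<gamma>. Q (succ_in \<Lambda> \<beta>)"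
    unfolding eventually_below[OF assms] by blast
qed

text \<open>Partition points are arbitrary reals, whereas the hypotheses provide limits over
  \<Lambda>; composition with \<open>last_elem\<close> passes from the latter to the former.\<close>

lemma filterlim_last_elem_below:
  assumes "limit_elem \<Lambda> \<gamma>"
  shows "filterlim last_elem (below \<gamma>) (at \<gamma> within {a..<\<gamma>})"
  unfolding filterlim_iff
proof (intro allI impI)
  fix Q assume "eventually Q (below \<gamma>)"
  then obtain \<beta>\<^sub>0 where \<beta>\<^sub>0: "\<beta>\<^sub>0 \<in> \<Lambda>" "\<beta>\<^sub>0 < \<gamma>" "\<And>\<beta>. \<beta> \<in> \<Lambda> \<Longrightarrow> \<beta>\<^sub>0 \<le> \<beta> \<Longrightarrow> \<beta> < \<gamma> \<Longrightarrow> Q \<beta>"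
    unfolding eventually_below[OF assms] by auto
  have "Q (last_elem t)" if t: "t \<in> {a..<\<gamma>}" "\<beta>\<^sub>0 \<le> t" for t
  proof (rule \<beta>\<^sub>0(3))
    have "t \<in> {a..b}" using t le_b[OF limit_elemD(1)[OF assms]] by auto
    with t \<beta>\<^sub>0(1) show "last_elem t \<in> \<Lambda>" "\<beta>\<^sub>0 \<le> last_elem t" "last_elem t < \<gamma>"
      using last_elem_mem last_elem_ge last_elem_le[of t] by auto
  qed
  with \<beta>\<^sub>0(2) show "\<forall>\<^sub>F t in at \<gamma> within {a..<\<gamma>}. Q (last_elem t)"
    unfolding eventually_at by (intro exI[of _ "\<gamma> - \<beta>\<^sub>0"]) (auto simp: dist_real_def)
qed

section \<open>Transfinite products\<close>

lemma partial_products_iff: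
  "partial_products \<Lambda> x p \<longleftrightarrow> p a = id_blinfun \<and>
     (\<forall>\<beta>\<in>\<Lambda>. \<beta> < b \<longrightarrow> p (succ_in \<Lambda> \<beta>) = x \<beta> o\<^sub>L p \<beta>) \<and>
     (\<forall>\<gamma>. limit_elem \<Lambda> \<gamma> \<longrightarrow> (p \<longlongrightarrow> p \<gamma>) (below \<gamma>))"
proof -
  have succ: "\<gamma> \<in> insert (Sup \<Lambda>) \<Lambda> \<and> is_succ_of \<Lambda> \<beta> \<gamma> \<longleftrightarrow>
      \<beta> \<in> \<Lambda> \<and> \<beta> < b \<and> \<gamma> = succ_in \<Lambda> \<beta>" for \<beta> \<gamma>
  proof
    assume "\<gamma> \<in> insert (Sup \<Lambda>) \<Lambda> \<and> is_succ_of \<Lambda> \<beta> \<gamma>"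
    then show "\<beta> \<in> \<Lambda> \<and> \<beta> < b \<and> \<gamma> = succ_in \<Lambda> \<beta>"
      using le_b[of \<gamma>] b_in unfolding is_succ_of_def Sup_eq by auto
  next
    assume "\<beta> \<in> \<Lambda> \<and> \<beta> < b \<and> \<gamma> = succ_in \<Lambda> \<beta>"
    then show "\<gamma> \<in> insert (Sup \<Lambda>) \<Lambda> \<and> is_succ_of \<Lambda> \<beta> \<gamma>"
      using succ_in_mem succ_in_greater unfolding is_succ_of_def by blast
  qed
  have "(\<forall>\<gamma>\<in>insert (Sup \<Lambda>) \<Lambda>. \<forall>\<beta>. is_succ_of \<Lambda> \<beta> \<gamma> \<longrightarrow> p \<gamma> = x \<beta> o\<^sub>L p \<beta>) \<longleftrightarrow>
      (\<forall>\<beta>\<in>\<Lambda>. \<beta> < b \<longrightarrow> p (succ_in \<Lambda> \<beta>) = x \<beta> o\<^sub>L p \<beta>)"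
    (is "?L \<longleftrightarrow> ?R")
  proof -
    have "?L \<longleftrightarrow> (\<forall>\<gamma> \<beta>. \<gamma> \<in> insert (Sup \<Lambda>) \<Lambda> \<and> is_succ_of \<Lambda> \<beta> \<gamma> \<longrightarrow> p \<gamma> = x \<beta> o\<^sub>L p \<beta>)"
      by blast
    also have "\<dots> \<longleftrightarrow> ?R"
      unfolding succ by blast
    finally show ?thesis .
  qed
  moreover have "(\<forall>\<epsilon>>0. \<exists>\<beta>\<^sub>0\<in>\<Lambda>. \<beta>\<^sub>0 < \<gamma> \<and> (\<forall>\<beta>\<in>\<Lambda> \<inter> {\<beta>\<^sub>0..<\<gamma>}. norm (p \<beta> - p \<gamma>) < \<epsilon>)) \<longleftrightarrow>
      (p \<longlongrightarrow> p \<gamma>) (below \<gamma>)" if "limit_elem \<Lambda> \<gamma>" for \<gamma>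
    unfolding tendsto_iff eventually_below[OF that] dist_norm by (rule refl)
  ultimately show ?thesis
    unfolding partial_products_def min_of_eq by auto
qed

text \<open>At a limit element the value is forced, since \<open>below \<gamma>\<close> is a proper
  filter and limits are unique. This justifies the \<open>THE\<close> in
  \<open>family_product\<close>.\<close>

lemma partial_products_unique:
  assumes "partial_products \<Lambda> x p" "partial_products \<Lambda> x p'" "\<gamma> \<in> \<Lambda>"
  shows "p \<gamma> = p' \<gamma>"
  using assms(3)
proof (induction rule: elem_induct)
  case (limit \<gamma>)
  have "(p \<longlongrightarrow> p \<gamma>) (below \<gamma>)" "(p' \<longlongrightarrow> p' \<gamma>) (below \<gamma>)"
    using assms(1,2) limit(1) unfolding partial_products_iff by auto
  moreover have "\<forall>\<^sub>F \<beta> in below \<gamma>. p \<beta> = p' \<beta>"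
    using eventually_below_less[OF limit(1)] by eventually_elim (use limit(2) in auto)
  ultimately have "(p' \<longlongrightarrow> p \<gamma>) (below \<gamma>)"
    using Lim_transform_eventually by blast
  then show ?case
    using tendsto_unique[OF below_neq_bot[OF limit(1)]] \<open>(p' \<longlongrightarrow> p' \<gamma>) (below \<gamma>)\<close> by blast
qed (use assms(1,2) in \<open>auto simp: partial_products_iff\<close>)

lemma family_product_eq:
  assumes "partial_products \<Lambda> x p"
  shows "family_product \<Lambda> x = x b o\<^sub>L p b"
proof -
  have "has_family_product \<Lambda> x Q \<longleftrightarrow> Q = x b o\<^sub>L p b" for Q
    unfolding has_family_product_def Sup_eq
    using assms b_in by (auto dest: partial_products_unique[OF assms _ b_in])
  then show ?thesis
    unfolding family_product_def by (intro the_equality) simp_all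
qed

text \<open>
  Non-invertibility propagates upwards: through successors because the factors are invertible, and
  through limits because the invertible operators form an open set.
\<close>

lemma partial_products_invertible:
  fixes x p :: "real \<Rightarrow> ('x::banach \<Rightarrow>\<^sub>L 'x)"
  assumes pp: "partial_products \<Lambda> x p"
    and x: "\<And>\<alpha>. \<alpha> \<in> \<Lambda> \<Longrightarrow> invertible_op (x \<alpha>)"
    and pb: "invertible_op (p b)" and "\<gamma>\<^sub>0 \<in> \<Lambda>"
  shows "invertible_op (p \<gamma>\<^sub>0)"
proof (rule ccontr)
  assume *: "\<not> invertible_op (p \<gamma>\<^sub>0)"
  have "\<gamma>\<^sub>0 \<le> \<gamma> \<longrightarrow> \<not> invertible_op (p \<gamma>)" if "\<gamma> \<in> \<Lambda>" for \<gamma>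
    using that
  proof (induction rule: elem_induct)
    case min
    then show ?case using * ge_a[OF \<open>\<gamma>\<^sub>0 \<in> \<Lambda>\<close>] by auto
  next
    case (succ \<beta>)
    have "p (succ_in \<Lambda> \<beta>) = x \<beta> o\<^sub>L p \<beta>"
      using pp succ(1,2) unfolding partial_products_iff by blast
    then have "invertible_op (p (succ_in \<Lambda> \<beta>)) \<Longrightarrow> invertible_op (p \<beta>)"
      using invertible_op_cancel_left[OF x[OF succ(1)]] by simp
    \<comment> \<open>If the successor is at least \<open>\<gamma>\<^sub>0\<close> but \<beta> is
      not, then the successor is \<open>\<gamma>\<^sub>0\<close> itself.\<close>
    moreover have "\<gamma>\<^sub>0 \<le> \<beta> \<or> succ_in \<Lambda> \<beta> \<le> \<gamma>\<^sub>0"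
      using succ_in_le[OF succ(1,2) \<open>\<gamma>\<^sub>0 \<in> \<Lambda>\<close>] by linarith
    ultimately show ?case
      using succ(3) * by (metis order_antisym)
  next
    case (limit \<gamma>)
    show ?case
    proof (intro impI notI)
      assume "\<gamma>\<^sub>0 \<le> \<gamma>" and inv: "invertible_op (p \<gamma>)"
      with * have "\<gamma>\<^sub>0 < \<gamma>" by (metis order_le_less)
      have "(p \<longlongrightarrow> p \<gamma>) (below \<gamma>)"
        using pp limit(1) unfolding partial_products_iff by blast
      then have "\<forall>\<^sub>F \<beta> in below \<gamma>. invertible_op (p \<beta>)"
        by (rule invertible_op_eventually[OF inv])
      moreover have "\<forall>\<^sub>F \<beta> in below \<gamma>. \<not> invertible_op (p \<beta>)"
        unfolding eventually_below[OF limit(1)]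
        using \<open>\<gamma>\<^sub>0 < \<gamma>\<close> \<open>\<gamma>\<^sub>0 \<in> \<Lambda>\<close> limit(2) by (intro bexI[of _ \<gamma>\<^sub>0]) auto
      ultimately have "\<forall>\<^sub>F \<beta> in below \<gamma>. False"
        by eventually_elim simp
      then show False
        using below_neq_bot[OF limit(1)] by simp
    qed
  qed
  then show False
    using pb b_in le_b[OF \<open>\<gamma>\<^sub>0 \<in> \<Lambda>\<close>] by blast
qed

text \<open>The right end of the step with index \<alpha>. The last step is the single point
  \<open>b\<close>; the value \<open>b + 1\<close> gives it positive length, so that a positive
  error is allowed at \<open>b\<close> too.\<close>

definition next_elem :: "real \<Rightarrow> real" where
  "next_elem \<alpha> = (if \<alpha> < b then succ_in \<Lambda> \<alpha> else b + 1)"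

lemma next_elem_le: "\<alpha> \<in> \<Lambda> \<Longrightarrow> \<gamma> \<in> \<Lambda> \<Longrightarrow> \<alpha> < \<gamma> \<Longrightarrow> next_elem \<alpha> \<le> \<gamma>"
  using succ_in_le le_b[of \<gamma>] unfolding next_elem_def by auto

lemma last_elem_next:
  assumes "\<gamma> \<in> \<Lambda>" "\<gamma> \<le> t" "t < next_elem \<gamma>" "t \<le> b"
  shows "last_elem t = \<gamma>"
proof (cases "\<gamma> < b")
  case False
  with assms le_b[of \<gamma>] have "t = \<gamma>" by auto
  with last_elem_self assms(1) show ?thesis by simp
qed (use assms last_elem_step in \<open>auto simp: next_elem_def\<close>)

lemma less_next_last:
  assumes "t \<in> {a..b}"
  shows "t < next_elem (last_elem t)"
  using assms
proof (cases rule: step_cases)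
  case 2
  then show ?thesis by (simp add: next_elem_def)
qed (simp add: next_elem_def)

end

section \<open>Step functions and products\<close>

text \<open>Here \<open>q\<close> is U of the overview, described by its own recursion. A limit
  element contributes the factor I, hence U has no jump there, which is
  \<open>q_limit\<close>.\<close>

locale step_product = step_set +
  fixes z q :: "real \<Rightarrow> ('x::banach \<Rightarrow>\<^sub>L 'x)"
  assumes q_min: "q a = id_blinfun"
    and q_succ: "\<And>\<beta>. \<beta> \<in> \<Lambda> \<Longrightarrow> \<beta> < b \<Longrightarrow>
      q (succ_in \<Lambda> \<beta>) = (id_blinfun + z (succ_in \<Lambda> \<beta>) - z \<beta>) o\<^sub>L q \<beta>"
    and q_limit: "\<And>\<gamma>. limit_elem \<Lambda> \<gamma> \<Longrightarrow> (q \<longlongrightarrow> q \<gamma>) (below \<gamma>)"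
    and z_limit: "\<And>\<gamma>. limit_elem \<Lambda> \<gamma> \<Longrightarrow> (z \<longlongrightarrow> z \<gamma>) (below \<gamma>)"
begin

text \<open>One limit serves for both kinds of elements: before a successor the expression is
  constant on the preceding step, by \<open>q_succ\<close>; at a limit element the difference of the
  values of \<open>z\<close> vanishes in the limit.\<close>

lemma jump_tendsto:
  assumes "\<gamma> \<in> \<Lambda>" "a < \<gamma>"
  shows "((\<lambda>s. (id_blinfun + z \<gamma> - z (last_elem s)) o\<^sub>L q (last_elem s)) \<longlongrightarrow> q \<gamma>)
    (at \<gamma> within {a..<\<gamma>})"
  using assms(1)
proof (cases rule: elem_cases)
  case (2 \<beta>)
  have "(id_blinfun + z \<gamma> - z (last_elem s)) o\<^sub>L q (last_elem s) = q \<gamma>" if "s \<in> {\<beta>..<\<gamma>}" for s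
    using 2 q_succ[of \<beta>] last_elem_step[of \<beta> s] that by simp
  then have "\<forall>\<^sub>F s in at \<gamma> within {a..<\<gamma>}.
      (id_blinfun + z \<gamma> - z (last_elem s)) o\<^sub>L q (last_elem s) = q \<gamma>"
    unfolding eventually_at using 2 succ_in_greater[of \<beta>]
    by (intro exI[of _ "\<gamma> - \<beta>"]) (auto simp: dist_real_def)
  then show ?thesis by (rule tendsto_eventually)
next
  case 3
  have "((\<lambda>\<beta>. (id_blinfun + z \<gamma> - z \<beta>) o\<^sub>L q \<beta>) \<longlongrightarrow> (id_blinfun + z \<gamma> - z \<gamma>) o\<^sub>L q \<gamma>) (below \<gamma>)"
    by (intro compose.tendsto tendsto_intros z_limit q_limit 3)
  from filterlim_compose[OF this filterlim_last_elem_below[OF 3]]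
  show ?thesis by simp
qed (use assms in simp)

text \<open>
  The error of a single factor is bounded by the increment of \<open>c * next_elem (last_elem t)\<close>. As
  this function is monotone, the errors add up to at most \<open>c * (b + 1 - a)\<close>, however many limit
  elements the partition meets.
\<close>

lemma local_gauge:
  assumes r: "\<And>\<gamma>. \<gamma> \<in> \<Lambda> \<Longrightarrow> r \<gamma> o\<^sub>L q \<gamma> = id_blinfun"
    and c: "c > 0" and \<xi>: "\<xi> \<in> {a..b}"
  shows "\<exists>d>0. \<forall>s t. a \<le> s \<and> s \<le> \<xi> \<and> \<xi> \<le> t \<and> t \<le> b \<and> \<xi> - d < s \<and> t < \<xi> + d \<longrightarrow>
    norm ((r (last_elem t) o\<^sub>L ((id_blinfun + z (last_elem t) - z (last_elem s)) o\<^sub>L q (last_elem s)))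
        - id_blinfun)
      \<le> c * next_elem (last_elem t) - c * next_elem (last_elem s)"
    (is "\<exists>d>0. \<forall>s t. ?near d s t \<longrightarrow> norm (?G (last_elem s) (last_elem t) - id_blinfun) \<le> ?h t - ?h s")
proof -
  define \<gamma> where "\<gamma> = last_elem \<xi>"
  have \<gamma>: "\<gamma> \<in> \<Lambda>" "\<gamma> \<le> \<xi>" "\<xi> < next_elem \<gamma>"
    using last_elem_mem[OF \<xi>] last_elem_le[OF \<xi>] less_next_last[OF \<xi>] by (auto simp: \<gamma>_def)
  have same: "?G \<gamma> \<gamma> = id_blinfun"
    using r[OF \<gamma>(1)] by simp
  have last_t: "last_elem t = \<gamma>" if "?near d s t" "d \<le> next_elem \<gamma> - \<xi>" for d s t
    using \<gamma> that by (intro last_elem_next) auto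
  \<comment> \<open>Inside a step, and at \<open>a\<close>, where \<open>s = a\<close> is forced,
    both endpoints belong to the same step and the conjugated factor is exactly the identity. Only
    the start of a step above \<open>a\<close> needs an estimate.\<close>
  consider "\<gamma> < \<xi>" | "\<xi> = \<gamma>" "\<gamma> = a" | "\<xi> = \<gamma>" "a < \<gamma>"
    using \<gamma>(2) ge_a[OF \<gamma>(1)] by linarith
  then show ?thesis
  proof cases
    case 1
    define d where "d = min (\<xi> - \<gamma>) (next_elem \<gamma> - \<xi>)"
    have "d > 0" using 1 \<gamma> by (auto simp: d_def)
    moreover have "last_elem s = \<gamma> \<and> last_elem t = \<gamma>" if "?near d s t" for s t
      using that last_t[OF that] \<gamma> \<xi> by (auto simp: d_def intro!: last_elem_next)
    ultimately show ?thesis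
      using same by (intro exI[of _ d]) auto
  next
    case 2
    define d where "d = next_elem \<gamma> - \<xi>"
    have "d > 0" using \<gamma> by (auto simp: d_def)
    moreover have "last_elem s = \<gamma> \<and> last_elem t = \<gamma>" if "?near d s t" for s t
    proof -
      have "s = \<gamma>" using that 2 by linarith
      then show ?thesis using last_t[OF that] last_elem_self[OF \<gamma>(1)] by (simp add: d_def)
    qed
    ultimately show ?thesis
      using same by (intro exI[of _ d]) auto
  next
    case 3
    \<comment> \<open>For \<open>s < \<gamma>\<close> the step of \<open>s\<close> ends at or before
      \<gamma>, so the increment available for the error is at least \<open>e\<close>.\<close>
    define e where "e = c * (next_elem \<gamma> - \<gamma>)"
    have "e > 0" using c \<gamma> 3 by (simp add: e_def)
    have "((\<lambda>s. ?G (last_elem s) \<gamma>) \<longlongrightarrow> r \<gamma> o\<^sub>L q \<gamma>) (at \<gamma> within {a..<\<gamma>})"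
      by (intro compose.tendsto tendsto_const jump_tendsto \<gamma> 3)
    then have "\<forall>\<^sub>F s in at \<gamma> within {a..<\<gamma>}. dist (?G (last_elem s) \<gamma>) id_blinfun < e"
      using \<open>e > 0\<close> r[OF \<gamma>(1)] by (simp add: tendsto_iff)
    then obtain d1 where d1: "d1 > 0"
      "\<forall>s\<in>{a..<\<gamma>}. s \<noteq> \<gamma> \<and> dist s \<gamma> < d1 \<longrightarrow> dist (?G (last_elem s) \<gamma>) id_blinfun < e"
      unfolding eventually_at by blast
    define d where "d = min d1 (next_elem \<gamma> - \<xi>)"
    have "d > 0" using d1(1) \<gamma> by (auto simp: d_def)
    moreover have "norm (?G (last_elem s) (last_elem t) - id_blinfun) \<le> ?h t - ?h s"
      if near: "?near d s t" for s t
    proof -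
      have t: "last_elem t = \<gamma>"
        using last_t[OF near] by (simp add: d_def)
      show ?thesis
      proof (cases "s = \<gamma>")
        case True
        then show ?thesis using t same last_elem_self[OF \<gamma>(1)] by simp
      next
        case False
        with near 3 have s: "s \<in> {a..<\<gamma>}" "dist s \<gamma> < d1" "s \<in> {a..b}"
          by (auto simp: d_def dist_real_def)
        then have "next_elem (last_elem s) \<le> \<gamma>"
          using last_elem_mem[OF s(3)] last_elem_le[OF s(3)] \<gamma>(1) by (intro next_elem_le) auto
        then have "e \<le> ?h t - ?h s"
          using c t by (simp add: e_def right_diff_distrib)
        moreover have "norm (?G (last_elem s) \<gamma> - id_blinfun) < e"
          using d1(2) s by (auto simp: dist_norm)
        ultimately show ?thesis using t by simp
      qed
    qed
    ultimately show ?thesis by blast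
  qed
qed

lemma has_KS_product_step:
  assumes A: "\<And>t. t \<in> {a..b} \<Longrightarrow> A t = z (last_elem t)"
    and inv: "\<And>\<gamma>. \<gamma> \<in> \<Lambda> \<Longrightarrow> invertible_op (q \<gamma>)"
  shows "has_KS_product a b A (q b)"
  unfolding has_KS_product_iff fine_limit_def
proof (intro conjI allI impI)
  show "invertible_op (q b)" by (rule inv[OF b_in])
next
  fix \<epsilon> :: real assume "\<epsilon> > 0"
  have "\<forall>\<gamma>\<in>\<Lambda>. \<exists>R. q \<gamma> o\<^sub>L R = id_blinfun \<and> R o\<^sub>L q \<gamma> = id_blinfun"
    using inv unfolding invertible_op_def by blast
  from bchoice[OF this] obtain r
    where r: "\<And>\<gamma>. \<gamma> \<in> \<Lambda> \<Longrightarrow> q \<gamma> o\<^sub>L r \<gamma> = id_blinfun" "\<And>\<gamma>. \<gamma> \<in> \<Lambda> \<Longrightarrow> r \<gamma> o\<^sub>L q \<gamma> = id_blinfun"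
    by blast
  \<comment> \<open>The choice of \<open>c\<close> makes \<open>exp (c * (b + 1 - a)) - 1\<close>
    equal to \<eta>, and \<open>norm (q b) * \<eta>\<close> is less than \<epsilon>. The length
    \<open>b + 1 - a\<close> is positive even for \<open>a = b\<close>.\<close>
  define \<eta> where "\<eta> = \<epsilon> / (norm (q b) + 1)"
  define c where "c = ln (1 + \<eta>) / (b + 1 - a)"
  have pos: "norm (q b) + 1 > 0" using norm_ge_zero[of "q b"] by linarith
  with \<open>\<epsilon> > 0\<close> have "\<eta> > 0" by (simp add: \<eta>_def)
  then have "c > 0" using a_le_b by (simp add: c_def)
  let ?G = "\<lambda>s t. r (last_elem t) o\<^sub>L
    ((id_blinfun + z (last_elem t) - z (last_elem s)) o\<^sub>L q (last_elem s))"
  define h where "h t = c * next_elem (last_elem t)" for t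
  have "\<forall>\<xi>\<in>{a..b}. \<exists>d>0. \<forall>s t. a \<le> s \<and> s \<le> \<xi> \<and> \<xi> \<le> t \<and> t \<le> b \<and> \<xi> - d < s \<and> t < \<xi> + d \<longrightarrow>
      norm (?G s t - id_blinfun) \<le> h t - h s"
    using local_gauge[OF r(2) \<open>c > 0\<close>] unfolding h_def by blast
  from bchoice[OF this] obtain \<delta> where \<delta>: "\<forall>\<xi>\<in>{a..b}. 0 < \<delta> \<xi>"
    and local: "\<And>\<xi> s t. \<xi> \<in> {a..b} \<Longrightarrow> a \<le> s \<Longrightarrow> s \<le> \<xi> \<Longrightarrow> \<xi> \<le> t \<Longrightarrow> t \<le> b \<Longrightarrow>
      \<xi> - \<delta> \<xi> < s \<Longrightarrow> t < \<xi> + \<delta> \<xi> \<Longrightarrow> norm (?G s t - id_blinfun) \<le> h t - h s"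
    by blast
  have "norm (lprod (\<lambda>i. id_blinfun + A (t (Suc i)) - A (t i)) m - q b) < \<epsilon>"
    if part: "tagged_partition a b m \<xi> t" and fine: "delta_fine \<delta> m \<xi> t" for m \<xi> t
  proof -
    let ?F = "\<lambda>i. id_blinfun + A (t (Suc i)) - A (t i)"
    have range: "t i \<in> {a..b}" if "i \<le> m" for i
      using tagged_partition_range[OF part that] by simp
    have ends: "t 0 = a" "t m = b"
      using part by (auto simp: tagged_partition_def)
    have "norm ((lprod ?F m o\<^sub>L q (last_elem (t 0))) - q (last_elem (t m)))
        \<le> norm (q (last_elem (t m))) * (exp (h (t m) - h (t 0)) - 1)"
    proof (rule lprod_conjugated_bound[where V = "\<lambda>i. r (last_elem (t i))"])
      fix i assume "i < m"
      then have tag: "t i \<le> \<xi> i" "\<xi> i \<le> t (Suc i)"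
        and sub: "{t i..t (Suc i)} \<subseteq> {\<xi> i - \<delta> (\<xi> i)<..<\<xi> i + \<delta> (\<xi> i)}"
        using part fine by (auto simp: tagged_partition_def delta_fine_def)
      have rg: "t i \<in> {a..b}" "t (Suc i) \<in> {a..b}"
        using range \<open>i < m\<close> by auto
      have "t i \<in> {t i..t (Suc i)}" "t (Suc i) \<in> {t i..t (Suc i)}"
        using tag by auto
      then have "\<xi> i - \<delta> (\<xi> i) < t i" "t (Suc i) < \<xi> i + \<delta> (\<xi> i)"
        using sub by (meson greaterThanLessThan_iff subsetD)+
      then have "norm (?G (t i) (t (Suc i)) - id_blinfun) \<le> h (t (Suc i)) - h (t i)"
        using tag rg by (intro local[of "\<xi> i"]) auto
      then show "norm ((r (last_elem (t (Suc i))) o\<^sub>L (?F i o\<^sub>L q (last_elem (t i)))) - id_blinfun)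
          \<le> h (t (Suc i)) - h (t i)"
        using A rg by simp
    qed (use r last_elem_mem range in auto)
    then have "norm (lprod ?F m - q b) \<le> norm (q b) * (exp (h b - h a) - 1)"
      by (simp add: ends last_elem_self a_in b_in q_min)
    also have "\<dots> \<le> norm (q b) * (exp (c * (b + 1 - a)) - 1)"
    proof -
      \<comment> \<open>As \<open>next_elem\<close> is \<open>b + 1\<close> at \<open>b\<close> and
        at least \<open>a\<close> at \<open>a\<close>, the increments of \<open>h\<close> add up to
        at most \<open>c * (b + 1 - a)\<close>.\<close>
      have "a \<le> next_elem (last_elem a)"
        using less_next_last[of a] a_le_b by simp
      then have "h b - h a \<le> c * (b + 1 - a)"
        using \<open>c > 0\<close> by (simp add: h_def last_elem_self b_in next_elem_def[of b] right_diff_distrib)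
      then show ?thesis by (intro mult_left_mono) auto
    qed
    also have "\<dots> = norm (q b) * \<eta>"
      using \<open>\<eta> > 0\<close> a_le_b by (simp add: c_def)
    also have "\<dots> < (norm (q b) + 1) * \<eta>"
      using \<open>\<eta> > 0\<close> by simp
    also have "\<dots> = \<epsilon>"
      using pos by (simp add: \<eta>_def)
    finally show ?thesis .
  qed
  with \<delta> show "\<exists>\<delta>. (\<forall>s\<in>{a..b}. 0 < \<delta> s) \<and>
    (\<forall>m \<xi> t. tagged_partition a b m \<xi> t \<and> delta_fine \<delta> m \<xi> t \<longrightarrow>
       norm (lprod (\<lambda>i. id_blinfun + A (t (Suc i)) - A (t i)) m - q b) < \<epsilon>)"
    by blast
qed

section \<open>Products of projections\<close>

context
  assumes idem: "\<And>\<alpha>. \<alpha> \<in> \<Lambda> \<Longrightarrow> z \<alpha> o\<^sub>L z \<alpha> = z \<alpha>"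
begin

text \<open>Both claims advance together: absorption at \<beta> reduces the jump factor to
  \<open>z (succ_in \<Lambda> \<beta>)\<close>, idempotence of that factor gives absorption at the
  successor, and limit elements follow by passing to the limit.\<close>

lemma absorb: "\<gamma> \<in> \<Lambda> \<Longrightarrow> z \<gamma> o\<^sub>L (q \<gamma> o\<^sub>L z a) = q \<gamma> o\<^sub>L z a"
  and q_succ_z: "\<beta> \<in> \<Lambda> \<Longrightarrow> \<beta> < b \<Longrightarrow> q (succ_in \<Lambda> \<beta>) o\<^sub>L z a = z (succ_in \<Lambda> \<beta>) o\<^sub>L (q \<beta> o\<^sub>L z a)"
proof -
  have step: "q (succ_in \<Lambda> \<beta>) o\<^sub>L z a = z (succ_in \<Lambda> \<beta>) o\<^sub>L (q \<beta> o\<^sub>L z a)"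
    if "\<beta> \<in> \<Lambda>" "\<beta> < b" "z \<beta> o\<^sub>L (q \<beta> o\<^sub>L z a) = q \<beta> o\<^sub>L z a" for \<beta>
    by (simp add: q_succ that blinfun_compose_assoc compose.add_left compose.diff_left)
  show absorb: "z \<gamma> o\<^sub>L (q \<gamma> o\<^sub>L z a) = q \<gamma> o\<^sub>L z a" if "\<gamma> \<in> \<Lambda>" for \<gamma>
    using that
  proof (induction rule: elem_induct)
    case min
    then show ?case using idem[OF a_in] by (simp add: q_min)
  next
    case (succ \<beta>)
    then show ?case
      using idem[OF succ_in_mem[OF succ(1,2)]] by (simp add: step flip: blinfun_compose_assoc)
  next
    case (limit \<gamma>)
    have "((\<lambda>\<beta>. z \<beta> o\<^sub>L (q \<beta> o\<^sub>L z a)) \<longlongrightarrow> z \<gamma> o\<^sub>L (q \<gamma> o\<^sub>L z a)) (below \<gamma>)"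
      by (intro compose.tendsto tendsto_const z_limit q_limit limit)
    moreover have "\<forall>\<^sub>F \<beta> in below \<gamma>. z \<beta> o\<^sub>L (q \<beta> o\<^sub>L z a) = q \<beta> o\<^sub>L z a"
      using eventually_below_less[OF limit(1)] by eventually_elim (use limit(2) in auto)
    ultimately have "((\<lambda>\<beta>. q \<beta> o\<^sub>L z a) \<longlongrightarrow> z \<gamma> o\<^sub>L (q \<gamma> o\<^sub>L z a)) (below \<gamma>)"
      by (rule Lim_transform_eventually)
    moreover have "((\<lambda>\<beta>. q \<beta> o\<^sub>L z a) \<longlongrightarrow> q \<gamma> o\<^sub>L z a) (below \<gamma>)"
      by (intro compose.tendsto tendsto_const q_limit limit)
    ultimately show ?case
      using tendsto_unique below_neq_bot[OF limit(1)] by blast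
  qed
  show "q (succ_in \<Lambda> \<beta>) o\<^sub>L z a = z (succ_in \<Lambda> \<beta>) o\<^sub>L (q \<beta> o\<^sub>L z a)" if "\<beta> \<in> \<Lambda>" "\<beta> < b"
    using step absorb that by blast
qed

text \<open>Here \<open>p\<close> stands for the products of the \<open>x \<alpha>\<close> over
  \<alpha> < \<gamma>. The candidate \<open>y\<close> is split at \<open>a\<close>, because the
  factor \<open>z a\<close> enters only after the empty product.\<close>

lemma projection_products:
  assumes p_succ: "\<And>\<beta>. \<beta> \<in> \<Lambda> \<Longrightarrow> \<beta> < b \<Longrightarrow> p (succ_in \<Lambda> \<beta>) = q \<beta>"
    and p_limit: "\<And>\<gamma>. limit_elem \<Lambda> \<gamma> \<Longrightarrow> p \<gamma> = q \<gamma>"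
      "\<And>\<gamma>. limit_elem \<Lambda> \<gamma> \<Longrightarrow> (p \<longlongrightarrow> p \<gamma>) (below \<gamma>)"
  defines "y \<equiv> \<lambda>\<gamma>. if \<gamma> = a then id_blinfun else p \<gamma> o\<^sub>L z a"
  shows "partial_products \<Lambda> z y" and "z b o\<^sub>L y b = q b o\<^sub>L z a"
proof -
  have y_succ: "y (succ_in \<Lambda> \<beta>) = q \<beta> o\<^sub>L z a" if "\<beta> \<in> \<Lambda>" "\<beta> < b" for \<beta>
    using that succ_in_greater[OF that] ge_a[OF that(1)] by (simp add: y_def p_succ)
  \<comment> \<open>At a limit element the family \<open>x\<close> contributes I but
    \<open>z\<close> contributes \<open>z \<gamma>\<close>; \<open>absorb\<close> reconciles the
    two.\<close>
  have zy: "z \<gamma> o\<^sub>L y \<gamma> = q \<gamma> o\<^sub>L z a" if "\<gamma> \<in> \<Lambda>" for \<gamma>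
    using that
  proof (cases rule: elem_cases)
    case 1
    then show ?thesis by (simp add: y_def q_min)
  next
    case (2 \<beta>)
    then show ?thesis by (simp add: y_succ q_succ_z)
  next
    case 3
    then show ?thesis
      using absorb[OF that] limit_elemD(2)[OF 3] by (simp add: y_def p_limit)
  qed
  show "z b o\<^sub>L y b = q b o\<^sub>L z a"
    by (rule zy[OF b_in])
  show "partial_products \<Lambda> z y"
    unfolding partial_products_iff
  proof (intro conjI ballI allI impI)
    show "y a = id_blinfun" by (simp add: y_def)
  next
    fix \<beta> assume "\<beta> \<in> \<Lambda>" "\<beta> < b"
    then show "y (succ_in \<Lambda> \<beta>) = z \<beta> o\<^sub>L y \<beta>"
      by (simp add: y_succ zy)
  next
    fix \<gamma> assume \<gamma>: "limit_elem \<Lambda> \<gamma>"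
    have "((\<lambda>\<beta>. p \<beta> o\<^sub>L z a) \<longlongrightarrow> p \<gamma> o\<^sub>L z a) (below \<gamma>)"
      by (intro compose.tendsto tendsto_const p_limit \<gamma>)
    moreover have "\<forall>\<^sub>F \<beta> in below \<gamma>. p \<beta> o\<^sub>L z a = y \<beta>"
      using eventually_below_less[OF \<gamma>] by eventually_elim (auto simp: y_def)
    ultimately show "(y \<longlongrightarrow> y \<gamma>) (below \<gamma>)"
      using limit_elemD(2)[OF \<gamma>] by (auto simp: y_def intro: Lim_transform_eventually)
  qed
qed

end

end

theorem theorem7p6:
  fixes P :: "'m::t2_space \<Rightarrow> ('x::banach \<Rightarrow>\<^sub>L 'x)"
    and l :: "real \<Rightarrow> 'm"
    and a b :: real
    and \<Lambda> :: "real set"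
    and z x :: "real \<Rightarrow> ('x \<Rightarrow>\<^sub>L 'x)"
  assumes P: "projection_valued P"
    and l: "continuous_on {a..b} l"
    and \<Lambda>: "well_ordered \<Lambda>" "\<Lambda> \<subseteq> {a..b}" "a \<in> \<Lambda>" "b \<in> \<Lambda>"
    and steps_cover: "{a..<b} \<subseteq> (\<Union>\<alpha>\<in>\<Lambda> \<inter> {..<b}. {\<alpha>..<succ_in \<Lambda> \<alpha>})"
    and step: "\<And>\<alpha> t. \<alpha> \<in> \<Lambda> \<Longrightarrow> \<alpha> < b \<Longrightarrow> t \<in> {\<alpha>..<succ_in \<Lambda> \<alpha>} \<Longrightarrow> (P \<circ> l) t = z \<alpha>"
    and step_b: "(P \<circ> l) b = z b"
    and z_lim: "\<And>\<gamma>. \<gamma> \<in> \<Lambda> \<Longrightarrow> limit_elem \<Lambda> \<gamma> \<Longrightarrow> (z \<longlongrightarrow> z \<gamma>) (at \<gamma> within \<Lambda> \<inter> {..<\<gamma>})"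
    and x_a: "x a = id_blinfun"
    and x_lim: "\<And>\<gamma>. \<gamma> \<in> \<Lambda> \<Longrightarrow> limit_elem \<Lambda> \<gamma> \<Longrightarrow> x \<gamma> = id_blinfun"
    and x_succ: "\<And>\<beta>. \<beta> \<in> \<Lambda> \<Longrightarrow> \<beta> < b \<Longrightarrow>
                   x (succ_in \<Lambda> \<beta>) = id_blinfun + z (succ_in \<Lambda> \<beta>) - z \<beta>"
    and x_mult: "multipliable \<Lambda> x"
    and x_inv: "\<And>\<alpha>. \<alpha> \<in> \<Lambda> \<Longrightarrow> invertible_op (x \<alpha>)"
    and x_prod_inv: "invertible_op (family_product \<Lambda> x)"
  shows "KS_product_exists a b (P \<circ> l) \<and>
         KH_product_exists a b (P \<circ> l) \<and>
         multipliable \<Lambda> z \<and>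
         KH_product a b (P \<circ> l) = KS_product a b (P \<circ> l) o\<^sub>L P (l a) \<and>
         KS_product a b (P \<circ> l) o\<^sub>L P (l a) = family_product \<Lambda> z"
proof -
  interpret step_set \<Lambda> a b
    using \<Lambda> steps_cover by unfold_locales
  obtain p where p: "partial_products \<Lambda> x p"
    using x_mult unfolding multipliable_def by blast
  define q where "q \<gamma> = x \<gamma> o\<^sub>L p \<gamma>" for \<gamma>
  have p_min: "p a = id_blinfun"
    and p_succ: "\<And>\<beta>. \<beta> \<in> \<Lambda> \<Longrightarrow> \<beta> < b \<Longrightarrow> p (succ_in \<Lambda> \<beta>) = q \<beta>"
    and p_lim: "\<And>\<gamma>. limit_elem \<Lambda> \<gamma> \<Longrightarrow> (p \<longlongrightarrow> p \<gamma>) (below \<gamma>)"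
    using p unfolding partial_products_iff q_def by auto
  have q_lim: "q \<gamma> = p \<gamma>" if "limit_elem \<Lambda> \<gamma>" for \<gamma>
    using x_lim that limit_elemD(1) by (simp add: q_def)
  interpret step_product \<Lambda> a b z q
  proof
    show "q a = id_blinfun" by (simp add: q_def x_a p_min)
    show "q (succ_in \<Lambda> \<beta>) = (id_blinfun + z (succ_in \<Lambda> \<beta>) - z \<beta>) o\<^sub>L q \<beta>"
      if "\<beta> \<in> \<Lambda>" "\<beta> < b" for \<beta>
      using that by (simp add: q_def[of "succ_in \<Lambda> \<beta>"] p_succ x_succ)
    show "(z \<longlongrightarrow> z \<gamma>) (below \<gamma>)" if "limit_elem \<Lambda> \<gamma>" for \<gamma>
      using z_lim limit_elemD(1) that by blast
    show "(q \<longlongrightarrow> q \<gamma>) (below \<gamma>)" if \<gamma>: "limit_elem \<Lambda> \<gamma>" for \<gamma>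
    proof -
      \<comment> \<open>As \<open>q \<beta>\<close> is \<open>p\<close> at the successor of \<beta>,
        it inherits the limit of \<open>p\<close>, and \<open>q \<gamma> = p \<gamma>\<close>
        because \<open>x \<gamma>\<close> is the identity.\<close>
      have "((\<lambda>\<beta>. p (succ_in \<Lambda> \<beta>)) \<longlongrightarrow> p \<gamma>) (below \<gamma>)"
        by (rule filterlim_compose[OF p_lim[OF \<gamma>] filterlim_succ_below[OF \<gamma>]])
      moreover have "\<forall>\<^sub>F \<beta> in below \<gamma>. p (succ_in \<Lambda> \<beta>) = q \<beta>"
        using eventually_below_less[OF \<gamma>] by eventually_elim (simp add: p_succ)
      ultimately show ?thesis
        unfolding q_lim[OF \<gamma>] by (rule Lim_transform_eventually)
    qed
  qed
  have fam_x: "family_product \<Lambda> x = q b"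
    using family_product_eq[OF p] by (simp add: q_def)
  \<comment> \<open>The whole product is \<open>x b o\<^sub>L p b\<close>; cancelling
    \<open>x b\<close> supplies the hypothesis at the top from which invertibility of all
    \<open>p \<gamma>\<close> is derived.\<close>
  have "invertible_op (p b)"
    using invertible_op_cancel_left[OF x_inv[OF b_in], of "p b"] x_prod_inv fam_x
    by (simp add: q_def)
  then have q_inv: "invertible_op (q \<gamma>)" if "\<gamma> \<in> \<Lambda>" for \<gamma>
    unfolding q_def using partial_products_invertible[OF p x_inv _ that] x_inv[OF that]
    by (intro invertible_op_compose) auto
  have A: "(P \<circ> l) t = z (last_elem t)" if "t \<in> {a..b}" for t
    using that
  proof (cases rule: step_cases)
    case 1
    then show ?thesis using step_b by simp
  next
    case 2
    then show ?thesis using step by blast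
  qed
  have idem: "(P \<circ> l) t o\<^sub>L (P \<circ> l) t = (P \<circ> l) t" for t
    using P by (simp add: projection_valued_def)
  have z_eq: "z \<alpha> = (P \<circ> l) \<alpha>" if "\<alpha> \<in> \<Lambda>" for \<alpha>
    using A[of \<alpha>] last_elem_self[OF that] ge_a[OF that] le_b[OF that] by simp
  have z_idem: "z \<alpha> o\<^sub>L z \<alpha> = z \<alpha>" if "\<alpha> \<in> \<Lambda>" for \<alpha>
    unfolding z_eq[OF that] by (rule idem)
  have KS: "has_KS_product a b (P \<circ> l) (q b)"
    using has_KS_product_step[of "P \<circ> l"] A q_inv by blast
  have KH: "has_KH_product a b (P \<circ> l) (q b o\<^sub>L (P \<circ> l) a)"
    using has_KH_product_idempotent[OF idem KS] .
  define y where "y \<gamma> = (if \<gamma> = a then id_blinfun else p \<gamma> o\<^sub>L z a)" for \<gamma>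
  have y: "partial_products \<Lambda> z y" "z b o\<^sub>L y b = q b o\<^sub>L z a"
    using projection_products[OF z_idem p_succ q_lim[symmetric] p_lim] unfolding y_def by auto
  have "family_product \<Lambda> z = q b o\<^sub>L P (l a)"
    using family_product_eq[OF y(1)] y(2) z_eq[OF a_in] by simp
  moreover have "multipliable \<Lambda> z"
    using y(1) unfolding multipliable_def by blast
  ultimately show ?thesis
    using KS KH KS_product_eqI[OF a_le_b KS] KH_product_eqI[OF a_le_b KH]
    unfolding KS_product_exists_def KH_product_exists_def by auto
qed

end
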